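(* Let $\mu=(\mu_1,\dots,\mu_l)\vdash n$ with $l(\mu)=l$. Then $$\varphi^n_{1,1}(T_{\sigma_\mu})=\sum_{i=0}^{n-1}\chi^{(n-i,1^i)}_{\mu}(q)=(-1)^{n-l}\,2^{l-1}\prod_{i=1}^{l}[\mu_i]_{-q},$$ $$\varphi^n_{2,0}(T_{\sigma_\mu})=\sum_{i=0}^{[n/2]}(n-2i+1)\,\chi^{(n-i,i)}_{\mu}(q)=q^{n-2l}\prod_{i=1}^{l}\big(1+q+\mu_i(q-1)\big).$$
   Context: $[m]_v=1+v+\cdots+v^{m-1}$, and $[n/2]$ is the integer part of $n/2$. Hecke algebra. $H_n(q)$ is the unital associative $\mathbb C(q)$-algebra generated by $T_1,\dots,T_{n-1}$ with $T_iT_j=T_jT_i$ for $|i-j|>1$, $T_iT_{i+1}T_i=T_{i+1}T_iT_{i+1}$, and $T_i^2=(q-1)T_i+q$. For $w\in\mathfrak S_n$ with reduced expression $w=s_{i_1}\cdots s_{i_k}$, where $s_i=(i,i+1)$, put $T_w=T_{i_1}\cdots T_{i_k}$. For a composition $\mu=(\mu_1,\dots,\mu_l)$ of $n$, $\sigma_\mu=\sigma_{\mu_1}\times\cdots\times\sigma_{\mu_l}\in\mathfrak S_{\mu_1}\times\cdots\times\mathfrak S_{\mu_l}\subset\mathfrak S_n$, where $\sigma_r=(1\,2\cdots r)$. Irreducible characters $\chi^\lambda$ of $H_n(q)$ are labeled by partitions $\lambda\vdash n$, and $\chi^\lambda_\mu(q):=\chi^\lambda(T_{\sigma_\mu})$.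 By Ram's Frobenius formula (a known result, which also fixes the labeling), $\tilde q_\mu(q)=\sum_{\lambda\vdash n}\chi^\lambda_\mu(q)s_\lambda$, i.e. $\chi^\lambda_\mu(q)=\langle \tilde q_\mu(q),s_\lambda\rangle$, where $s_\lambda$ are the Schur functions, $\langle\cdot,\cdot\rangle$ is the bilinear form on symmetric functions for which they are orthonormal, $\tilde q_\mu(q)=\frac{q^{|\mu|}}{(q-1)^{l(\mu)}}\prod_i q_{\mu_i}(q^{-1})$, and $q_n(t)$ is defined by $\sum_{n\ge0}q_n(t)z^n=\exp\big(\sum_{n\ge1}\frac{1-t^n}{n}p_nz^n\big)$, with $p_n$ the power sums. Sign $q$-permutation representation. Let $V=V_{\bar0}\oplus V_{\bar1}$ be a $\mathbb Z_2$-graded $\mathbb C(q)$-vector space with basis $v_1,\dots,v_a$ of $V_{\bar0}$ and $v_{a+1},\dots,v_{a+b}$ of $V_{\bar1}$; $|v_k|\in\{0,1\}$ is the parity. Let $\pi$ be the endomorphism of $V\otimes V$ (written on the right) with $(v_k\otimes v_l)\pi=(-1)^{|v_k||v_l|}v_l\otimes v_k+(q-1)v_k\otimes v_l$ if $k<l$; $=\frac{(-1)^{|v_k|}(q+1)+q-1}{2}v_k\otimes v_l$ if $k=l$; $=(-1)^{|v_k||v_l|}q\,v_l\otimes v_k$ if $k>l$. Let $\pi_i$ act on $V^{\otimes n}$ as $\pi$ on the factors $(i,i+1)$ and as the identity elsewhere. It is known that $T_i\mapsto\pi_i$ defines a representation of $H_n(q)$ on $V^{\otimes n}$; $\varphi^n_{a,b}$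 is its character. It is known that $\varphi^n_{a,b}=\sum_{\lambda\vdash n,\ \lambda_{a+1}\le b}s_{a,b}(\lambda)\chi^\lambda$, where $s_{a,b}(\lambda)$ is the number of $(a,b)$-semistandard tableaux of shape $\lambda$.
   Formalization: The first equality is false as printed: for n=1, φ_{1,1}(1)=dim V=2 but the hook sum and the product are 1. It is corrected to φ^n_{1,1}(T_{σ_μ}) = 2·Σ_i χ^{(n-i,1^i)}_μ(q); the other three equalities are as printed, for n≥1. *)

theory Defs
  imports
    "Jordan_Normal_Form.VS_Connect"
    "HOL-Algebra.QuotRing"
    "HOL-Combinatorics.Cycles"
    "HOL-Computational_Algebra.Fraction_Field"
    "HOL-Computational_Algebra.Formal_Power_Series"
    "HOL-Library.Poly_Mapping"
begin

section \<open>The ground field and partitions\<close>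

text \<open>The field of rational functions over the complex numbers in the indeterminate \<open>qq\<close>.\<close>

type_synonym qfield = "complex poly fract"

definition qq :: qfield where
  "qq = Fraction_Field.Fract [:0, 1:] 1"

definition qint :: "qfield \<Rightarrow> nat \<Rightarrow> qfield" where
  "qint v m = (\<Sum>j<m. v ^ j)"

text \<open>Partitions are weakly decreasing lists of positive parts.\<close>

definition partitions_of :: "nat \<Rightarrow> nat list set" where
  "partitions_of n = {\<nu>. sorted_wrt (\<ge>) \<nu> \<and> (\<forall>p\<in>set \<nu>. 0 < p) \<and> sum_list \<nu> = n}"

definition hook :: "nat \<Rightarrow> nat \<Rightarrow> nat list" where
  "hook n i = (n - i) # replicate i 1"

text \<open>The partition \<open>(n - i, i)\<close>; a zero part is dropped.\<close>

definition two_row :: "nat \<Rightarrow> nat \<Rightarrow> nat list" where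
  "two_row n i = filter (\<lambda>p. 0 < p) [n - i, i]"

section \<open>The Hecke algebra\<close>

text \<open>Words in the generators, with concatenation written additively: this makes the finitely
  supported functions on words (with the convolution product of \<open>Poly_Mapping\<close>) the free
  associative algebra on generators indexed by the natural numbers.\<close>

datatype gword = GWord (letters: "nat list")

instantiation gword :: monoid_add
begin

definition "0 = GWord []"

definition "u + v = GWord (letters u @ letters v)"

instance
  by standard (simp_all add: zero_gword_def plus_gword_def)

end

type_synonym free_elt = "gword \<Rightarrow>\<^sub>0 qfield"

definition fgen :: "nat \<Rightarrow> free_elt" where
  "fgen i = Poly_Mapping.single (GWord [i]) 1"

definition fconst :: "qfield \<Rightarrow> free_elt" where
  "fconst c = Poly_Mapping.single 0 c"

definition free_alg :: "nat \<Rightarrow> free_elt ring" where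
  "free_alg n =
     \<lparr>carrier = {f. \<forall>w\<in>Poly_Mapping.keys f. set (letters w) \<subseteq> {1..<n}},
      monoid.mult = (*), one = 1, zero = 0, add = (+)\<rparr>"

definition hecke_relations :: "nat \<Rightarrow> free_elt set" where
  "hecke_relations n =
     {fgen i * fgen j - fgen j * fgen i | i j.
        i \<in> {1..<n} \<and> j \<in> {1..<n} \<and> (i + 1 < j \<or> j + 1 < i)}
   \<union> {fgen i * fgen (i + 1) * fgen i - fgen (i + 1) * fgen i * fgen (i + 1) | i.
        i \<in> {1..<n} \<and> i + 1 \<in> {1..<n}}
   \<union> {fgen i * fgen i - (fconst (qq - 1) * fgen i + fconst qq) | i. i \<in> {1..<n}}"

definition hecke_ideal :: "nat \<Rightarrow> free_elt set" where
  "hecke_ideal n = genideal (free_alg n) (hecke_relations n)"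

definition hecke :: "nat \<Rightarrow> free_elt set ring" where
  "hecke n = free_alg n Quot hecke_ideal n"

definition hecke_class :: "nat \<Rightarrow> free_elt \<Rightarrow> free_elt set" where
  "hecke_class n f = a_r_coset (free_alg n) (hecke_ideal n) f"

definition hecke_gen :: "nat \<Rightarrow> nat \<Rightarrow> free_elt set" where
  "hecke_gen n i = hecke_class n (fgen i)"

subsection \<open>The basis elements and the permutations \<open>\<sigma>\<^sub>\<mu>\<close>\<close>

text \<open>Permutations are composed as functions, so that \<open>(1 2 \<dots> r) = s\<^sub>1 s\<^sub>2 \<dots> s\<^sub>r\<^sub>-\<^sub>1\<close>.\<close>

definition perm_of_word :: "nat list \<Rightarrow> nat \<Rightarrow> nat" where
  "perm_of_word w = foldr (\<lambda>i p. transpose i (i + 1) \<circ> p) w id"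

definition reduced_expr :: "nat \<Rightarrow> (nat \<Rightarrow> nat) \<Rightarrow> nat list \<Rightarrow> bool" where
  "reduced_expr n p w \<longleftrightarrow>
     set w \<subseteq> {1..<n} \<and> perm_of_word w = p \<and>
     (\<forall>w'. set w' \<subseteq> {1..<n} \<and> perm_of_word w' = p \<longrightarrow> length w \<le> length w')"

text \<open>The value does not depend on the reduced expression that is chosen (Matsumoto).\<close>

definition hecke_T :: "nat \<Rightarrow> (nat \<Rightarrow> nat) \<Rightarrow> free_elt set" where
  "hecke_T n p =
     foldr (\<lambda>i x. hecke_gen n i \<otimes>\<^bsub>hecke n\<^esub> x) (SOME w. reduced_expr n p w) \<one>\<^bsub>hecke n\<^esub>"

text \<open>\<open>sigma_from b \<mu>\<close> is the product of the cycles on the consecutive blocks of sizes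
  \<open>\<mu>\<^sub>1, \<mu>\<^sub>2, \<dots>\<close> of \<open>{b+1, b+2, \<dots>}\<close>.\<close>

fun sigma_from :: "nat \<Rightarrow> nat list \<Rightarrow> nat \<Rightarrow> nat" where
  "sigma_from b [] = id"
| "sigma_from b (m # ms) = cycle_of_list [b + 1..<b + m + 1] \<circ> sigma_from (b + m) ms"

definition sigma :: "nat list \<Rightarrow> nat \<Rightarrow> nat" where
  "sigma \<mu> = sigma_from 0 \<mu>"

subsection \<open>Representations and characters\<close>

text \<open>Multiplicativity together with the condition on constants gives linearity over the field.\<close>

definition hecke_rep :: "nat \<Rightarrow> nat \<Rightarrow> (free_elt set \<Rightarrow> qfield mat) \<Rightarrow> bool" where
  "hecke_rep n d \<rho> \<longleftrightarrow>
     \<rho> \<in> Ring.ring_hom (hecke n) (ring_mat TYPE(qfield) d ()) \<and>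
     (\<forall>c. \<rho> (hecke_class n (fconst c)) = c \<cdot>\<^sub>m 1\<^sub>m d)"

definition irreducible_rep :: "nat \<Rightarrow> nat \<Rightarrow> (free_elt set \<Rightarrow> qfield mat) \<Rightarrow> bool" where
  "irreducible_rep n d \<rho> \<longleftrightarrow>
     hecke_rep n d \<rho> \<and> 0 < d \<and>
     (\<forall>U. VectorSpace.subspace class_ring U (module_vec TYPE(qfield) d) \<and>
          (\<forall>x\<in>carrier (hecke n). \<forall>v\<in>U. \<rho> x *\<^sub>v v \<in> U)
        \<longrightarrow> U = {0\<^sub>v d} \<or> U = carrier_vec d)"

definition mat_trace :: "qfield mat \<Rightarrow> qfield" where
  "mat_trace A = sum_list (diag_mat A)"

definition hecke_character ::
  "nat \<Rightarrow> (free_elt set \<Rightarrow> qfield mat) \<Rightarrow> free_elt set \<Rightarrow> qfield" where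
  "hecke_character n \<rho> = restrict (\<lambda>x. mat_trace (\<rho> x)) (carrier (hecke n))"

definition irreducible_characters :: "nat \<Rightarrow> (free_elt set \<Rightarrow> qfield) set" where
  "irreducible_characters n = {hecke_character n \<rho> | d \<rho>. irreducible_rep n d \<rho>}"

section \<open>The sign \<open>q\<close>-permutation representation\<close>

definition parity :: "nat \<Rightarrow> nat \<Rightarrow> nat" where
  "parity a k = (if k \<le> a then 0 else 1)"

text \<open>The coefficient of \<open>v\<^sub>k\<^sub>' \<otimes> v\<^sub>l\<^sub>'\<close> in \<open>(v\<^sub>k \<otimes> v\<^sub>l)\<pi>\<close>.\<close>

definition pi_coeff :: "nat \<Rightarrow> nat \<times> nat \<Rightarrow> nat \<times> nat \<Rightarrow> qfield" where
  "pi_coeff a = (\<lambda>(k, l) kl'.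
     (if k < l then
        (-1) ^ (parity a k * parity a l) * of_bool (kl' = (l, k))
        + (qq - 1) * of_bool (kl' = (k, l))
      else if k = l then
        ((-1) ^ parity a k * (qq + 1) + qq - 1) / 2 * of_bool (kl' = (k, l))
      else
        (-1) ^ (parity a k * parity a l) * qq * of_bool (kl' = (l, k))))"

text \<open>The basis \<open>v\<^sub>k\<^sub>1 \<otimes> \<dots> \<otimes> v\<^sub>k\<^sub>n\<close> of the \<open>n\<close>-th tensor power, listed by its words of indices.\<close>

definition tensor_basis :: "nat \<Rightarrow> nat \<Rightarrow> nat list list" where
  "tensor_basis d n = List.n_lists n [1..<d + 1]"

text \<open>The coefficient of the basis vector \<open>u'\<close> in the image of the basis vector \<open>u\<close> under
  \<open>\<pi>\<^sub>i\<close>. The factors \<open>i\<close>, \<open>i + 1\<close> are the list positions \<open>i - 1\<close>, \<open>i\<close>.\<close>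

definition pi_word_coeff :: "nat \<Rightarrow> nat \<Rightarrow> nat list \<Rightarrow> nat list \<Rightarrow> qfield" where
  "pi_word_coeff a i u u' =
     pi_coeff a (u ! (i - 1), u ! i) (u' ! (i - 1), u' ! i)
     * of_bool (\<forall>j<length u. j \<noteq> i - 1 \<and> j \<noteq> i \<longrightarrow> u' ! j = u ! j)"

text \<open>Operators are written on the right, so matrices act on row vectors: the row index is the
  argument. In this way a product of operators becomes the product of matrices in the same order.\<close>

definition pi_mat :: "nat \<Rightarrow> nat \<Rightarrow> nat \<Rightarrow> nat \<Rightarrow> qfield mat" where
  "pi_mat a b n i =
     (let B = tensor_basis (a + b) n
      in mat (length B) (length B) (\<lambda>(r, s). pi_word_coeff a i (B ! r) (B ! s)))"

text \<open>The representation is determined on the carrier of the Hecke algebra by the images of the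
  generators, so the choice is immaterial.\<close>

definition sign_perm_rep :: "nat \<Rightarrow> nat \<Rightarrow> nat \<Rightarrow> free_elt set \<Rightarrow> qfield mat" where
  "sign_perm_rep a b n =
     (SOME \<rho>. hecke_rep n ((a + b) ^ n) \<rho> \<and>
              (\<forall>i\<in>{1..<n}. \<rho> (hecke_gen n i) = pi_mat a b n i))"

definition sign_perm_char :: "nat \<Rightarrow> nat \<Rightarrow> nat \<Rightarrow> free_elt set \<Rightarrow> qfield" where
  "sign_perm_char a b n = hecke_character n (sign_perm_rep a b n)"

section \<open>Symmetric functions\<close>

text \<open>Symmetric functions are taken as formal power series in the variables
  \<open>x\<^sub>0, x\<^sub>1, x\<^sub>2, \<dots>\<close>; a series is the family of its coefficients, indexed by
  finitely supported exponent vectors.\<close>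

typedef 'a mseries = "UNIV :: ((nat \<Rightarrow>\<^sub>0 nat) \<Rightarrow> 'a) set"
  morphisms mcoeff Mseries by simp

lemma mcoeff_Mseries [simp]: "mcoeff (Mseries f) m = f m"
  by (simp add: Mseries_inverse)

lemma mseries_eqI: "(\<And>m. mcoeff f m = mcoeff g m) \<Longrightarrow> f = g"
  by (metis mcoeff_inverse ext)

definition splits :: "(nat \<Rightarrow>\<^sub>0 nat) \<Rightarrow> ((nat \<Rightarrow>\<^sub>0 nat) \<times> (nat \<Rightarrow>\<^sub>0 nat)) set" where
  "splits m = {(u, v). u + v = m}"

lemma finite_splits [simp]: "finite (splits m)"
proof -
  let ?S = "{u. \<exists>v. u + v = m}"
  let ?P = "PiE (Poly_Mapping.keys m) (\<lambda>k. {..Poly_Mapping.lookup m k})"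
  have le: "Poly_Mapping.lookup u k \<le> Poly_Mapping.lookup m k" if "u \<in> ?S" for u k
    using that by (auto simp: lookup_add)
  have inj: "inj_on (\<lambda>u. restrict (Poly_Mapping.lookup u) (Poly_Mapping.keys m)) ?S"
  proof (rule inj_onI)
    fix u u'
    assume u: "u \<in> ?S" and u': "u' \<in> ?S"
      and eq: "restrict (Poly_Mapping.lookup u) (Poly_Mapping.keys m)
             = restrict (Poly_Mapping.lookup u') (Poly_Mapping.keys m)"
    show "u = u'"
    proof (rule poly_mapping_eqI)
      fix k
      show "Poly_Mapping.lookup u k = Poly_Mapping.lookup u' k"
      proof (cases "k \<in> Poly_Mapping.keys m")
        case True
        then show ?thesis using fun_cong[OF eq, of k] by simp
      next
        case False
        then have "Poly_Mapping.lookup m k = 0" by (simp add: in_keys_iff)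
        then show ?thesis using le[OF u, of k] le[OF u', of k] by simp
      qed
    qed
  qed
  have sub: "(\<lambda>u. restrict (Poly_Mapping.lookup u) (Poly_Mapping.keys m)) ` ?S \<subseteq> ?P"
    using le by (auto simp: PiE_iff)
  have finP: "finite ?P" by (intro finite_PiE) auto
  have fin: "finite ?S"
    by (rule finite_imageD[OF finite_subset[OF sub finP] inj])
  have "splits m \<subseteq> ?S \<times> ?S"
  proof
    fix p assume "p \<in> splits m"
    then obtain u v where p: "p = (u, v)" and uv: "u + v = m"
      by (auto simp: splits_def)
    have "v + u = m" using uv by (simp only: add.commute)
    then show "p \<in> ?S \<times> ?S" using p uv by blast
  qed
  then show ?thesis by (rule finite_subset) (intro finite_cartesian_product fin)
qed

instantiation mseries :: (comm_ring_1) comm_ring_1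
begin

definition "0 = Mseries (\<lambda>_. 0)"
definition "1 = Mseries (\<lambda>m. if m = 0 then 1 else 0)"
definition "f + g = Mseries (\<lambda>m. mcoeff f m + mcoeff g m)"
definition "- f = Mseries (\<lambda>m. - mcoeff f m)"
definition "f - g = Mseries (\<lambda>m. mcoeff f m - mcoeff g m)"
definition "f * g = Mseries (\<lambda>m. \<Sum>(u, v)\<in>splits m. mcoeff f u * mcoeff g v)"

instance
proof
  fix f g h :: "'a mseries"
  show "f + g + h = f + (g + h)" "f + g = g + f" "0 + f = f" "- f + f = 0" "f - g = f + - g"
    by (rule mseries_eqI, simp add: plus_mseries_def zero_mseries_def uminus_mseries_def
        minus_mseries_def ac_simps)+
  show "(0 :: 'a mseries) \<noteq> 1"
  proof
    assume "(0 :: 'a mseries) = 1"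
    then have "mcoeff (0 :: 'a mseries) 0 = mcoeff 1 0" by simp
    then show False by (simp add: zero_mseries_def one_mseries_def)
  qed
  show "f * g = g * f"
  proof (rule mseries_eqI)
    fix m
    show "mcoeff (f * g) m = mcoeff (g * f) m"
      unfolding times_mseries_def mcoeff_Mseries
      by (rule sum.reindex_bij_witness[where i = "\<lambda>(u, v). (v, u)" and j = "\<lambda>(u, v). (v, u)"])
        (auto simp: splits_def add.commute mult.commute)
  qed
  show "(f + g) * h = f * h + g * h"
    by (rule mseries_eqI)
      (simp add: times_mseries_def plus_mseries_def case_prod_unfold distrib_right sum.distrib)
  show "1 * f = f"
  proof (rule mseries_eqI)
    fix m
    have "mcoeff (1 * f) m = (\<Sum>p\<in>splits m. if p = (0, m) then mcoeff f m else 0)"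
      unfolding times_mseries_def mcoeff_Mseries
      by (rule sum.cong) (auto simp: one_mseries_def splits_def split: if_splits)
    also have "\<dots> = mcoeff f m"
    proof -
      have "(0, m) \<in> splits m" by (simp add: splits_def)
      then show ?thesis by (simp add: sum.delta)
    qed
    finally show "mcoeff (1 * f) m = mcoeff f m" .
  qed
  show "f * g * h = f * (g * h)"
  proof (rule mseries_eqI)
    fix m
    have "mcoeff (f * g * h) m
        = (\<Sum>p\<in>splits m. \<Sum>r\<in>splits (fst p). mcoeff f (fst r) * mcoeff g (snd r) * mcoeff h (snd p))"
      by (simp add: times_mseries_def case_prod_unfold sum_distrib_right)
    also have "\<dots> = (\<Sum>(p, r)\<in>Sigma (splits m) (\<lambda>p. splits (fst p)).
        mcoeff f (fst r) * mcoeff g (snd r) * mcoeff h (snd p))"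
      by (rule sum.Sigma) simp_all
    also have "\<dots> = (\<Sum>(p, r)\<in>Sigma (splits m) (\<lambda>p. splits (snd p)).
        mcoeff f (fst p) * (mcoeff g (fst r) * mcoeff h (snd r)))"
      by (rule sum.reindex_bij_witness[where
            i = "\<lambda>((a, bc), (b, c)). ((a + b, c), (a, b))" and
            j = "\<lambda>((ab, c), (a, b)). ((a, b + c), (b, c))"])
        (auto simp: splits_def add.assoc mult.assoc)
    also have "\<dots> = (\<Sum>p\<in>splits m. \<Sum>r\<in>splits (snd p).
        mcoeff f (fst p) * (mcoeff g (fst r) * mcoeff h (snd r)))"
      by (rule sum.Sigma[symmetric]) simp_all
    also have "\<dots> = mcoeff (f * (g * h)) m"
      by (simp add: times_mseries_def case_prod_unfold sum_distrib_left)
    finally show "mcoeff (f * g * h) m = mcoeff (f * (g * h)) m" .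
  qed
qed

end

definition mconst :: "'a::zero \<Rightarrow> 'a mseries" where
  "mconst c = Mseries (\<lambda>m. if m = 0 then c else 0)"

text \<open>The power sum \<open>p\<^sub>n\<close>, for positive \<open>n\<close>.\<close>

definition power_sum :: "nat \<Rightarrow> qfield mseries" where
  "power_sum n = Mseries (\<lambda>m. if \<exists>i. m = Poly_Mapping.single i n then 1 else 0)"

text \<open>The exponential of a power series in \<open>z\<close> without constant term: the summands \<open>F\<^sup>k / k!\<close> with
  \<open>k > n\<close> do not contribute to the coefficient of \<open>z\<^sup>n\<close>.\<close>

definition series_exp :: "qfield mseries fps \<Rightarrow> qfield mseries fps" where
  "series_exp F = Abs_fps (\<lambda>n. \<Sum>k\<le>n. mconst (1 / of_nat (fact k)) * fps_nth (F ^ k) n)"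

definition q_fun :: "nat \<Rightarrow> qfield \<Rightarrow> qfield mseries" where
  "q_fun n t = fps_nth (series_exp (Abs_fps (\<lambda>k.
     if k = 0 then 0 else mconst ((1 - t ^ k) / of_nat k) * power_sum k))) n"

definition q_tilde :: "nat list \<Rightarrow> qfield mseries" where
  "q_tilde \<mu> = mconst (qq ^ sum_list \<mu> / (qq - 1) ^ length \<mu>)
             * (\<Prod>m\<leftarrow>\<mu>. q_fun m (inverse qq))"

subsection \<open>Schur functions\<close>

definition diagram :: "nat list \<Rightarrow> (nat \<times> nat) set" where
  "diagram \<nu> = {(r, c). r < length \<nu> \<and> c < \<nu> ! r}"

definition ssyt :: "nat list \<Rightarrow> (nat \<times> nat \<Rightarrow> nat) set" where
  "ssyt \<nu> = {T \<in> extensional (diagram \<nu>).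
     (\<forall>r c. (r, c + 1) \<in> diagram \<nu> \<longrightarrow> T (r, c) \<le> T (r, c + 1)) \<and>
     (\<forall>r c. (r + 1, c) \<in> diagram \<nu> \<longrightarrow> T (r, c) < T (r + 1, c))}"

definition schur :: "nat list \<Rightarrow> qfield mseries" where
  "schur \<nu> = Mseries (\<lambda>m. of_nat (card
     {T \<in> ssyt \<nu>. \<forall>k. card {x \<in> diagram \<nu>. T x = k} = Poly_Mapping.lookup m k}))"

section \<open>The labeling of the irreducible characters\<close>

text \<open>\<open>\<chi>\<close> enumerates the irreducible characters of the Hecke algebra by the partitions of \<open>n\<close>, in the
  way that is fixed by Ram's Frobenius formula.\<close>

definition hecke_labeling :: "nat \<Rightarrow> (nat list \<Rightarrow> free_elt set \<Rightarrow> qfield) \<Rightarrow> bool" where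
  "hecke_labeling n \<chi> \<longleftrightarrow>
     bij_betw \<chi> (partitions_of n) (irreducible_characters n) \<and>
     (\<forall>\<mu>\<in>partitions_of n.
        q_tilde \<mu> = (\<Sum>\<nu>\<in>partitions_of n. mconst (\<chi> \<nu> (hecke_T n (sigma \<mu>))) * schur \<nu>))"

end

theory Submission
  imports Defs
begin


text \<open>
  Both chains of equalities are proved by computing a trace and a symmetric function separately and
  finding the same product over the parts of \<open>\<mu>\<close>.

  \<^emph>\<open>The trace.\<close> A reduced expression of \<open>\<sigma>\<^sub>\<mu>\<close> uses pairwise distinct generators, namely those
  \<open>s\<^sub>i\<close> for which \<open>i\<close> and \<open>i + 1\<close> lie in one block (\<open>reduced_expr_of_distinct\<close>). In a product of
  operators \<open>\<pi>\<^sub>i\<close> with distinct indices, the operator \<open>\<pi>\<^sub>i\<close> is the only one that can move a letter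
  across the boundary between the tensor positions \<open>i\<close> and \<open>i + 1\<close>; a step that exchanges two
  different letters there can thus never be undone and does not contribute to a diagonal
  coefficient (\<open>foldr_pi_op_diagonal\<close>). So the trace is the sum, over all words of letters, of a
  product of local weights. It factors over the blocks of \<open>\<mu>\<close>, and each factor is a sum of all
  entries of a power of a triangular matrix of size two (\<open>block_sum_two\<close>, \<open>block_sum_super\<close>). For this
  to speak about \<open>sign_perm_char\<close>, the operators \<open>\<pi>\<^sub>i\<close> have to define a representation of the
  quotient of the free algebra at all; that is \<open>hecke_rep_from_matrices\<close> together with the braid
  relation \<open>pi_op_braid\<close>.

  \<^emph>\<open>The sums of irreducible characters.\<close> By Frobenius' formula it is enough to find a linear
  functional whose values on Schur functions are the required coefficients, and to evaluate it on
  \<open>q_tilde \<mu>\<close>. The functionals are \<open>p\<^sub>k \<mapsto> s\<^sup>k + a\<close>, with \<open>s = a = 1\<close> for two rows and \<open>s = a = -1\<close>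
  for hooks. For a natural number \<open>a = N\<close> this is the substitution of \<open>s\<close> for \<open>x\<^sub>0\<close>, of \<open>1\<close> for
  \<open>x\<^sub>1, \<dots>, x\<^sub>N\<close>, and of \<open>0\<close> for the other variables, which can be read off from the coefficients of a
  series (\<open>specialise\<close>). The value \<open>a = -1\<close> is reached by polynomiality: both sides of Frobenius'
  formula are polynomials in \<open>N\<close>, so that they agree for every \<open>a\<close> (\<open>frobenius_specialised\<close>).

  The specialisation is multiplicative, and under it the generating function of the \<open>q\<^sub>m(t)\<close>
  becomes the rational function \<open>(1 - tsz)/(1 - sz) \<sqdot> ((1 - tz)/(1 - z))\<^sup>a\<close>, which is determined
  by its logarithmic derivative (\<open>spec_q_two\<close>, \<open>spec_q_super\<close>). On a Schur function, splitting off the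
  largest entries of a tableau expresses the value at \<open>a + 1\<close> as the sum of the values at \<open>a\<close> over all
  shapes that interlace the given one (\<open>schur_poly_branching\<close>). The value at \<open>a = 0\<close> is a single
  monomial or zero. One application of the branching rule leads from there to \<open>a = 1\<close>, and as the rule
  is triangular, it can also be solved backwards for \<open>a = -1\<close> (\<open>schur_poly_two\<close>, \<open>schur_poly_super\<close>).
\<close>


section \<open>The ground field\<close>

lemma of_nat_fract: "(of_nat k :: 'a::idom fract) = Fraction_Field.Fract (of_nat k) 1"
  by (induction k) (simp_all add: Zero_fract_def One_fract_def)

instance fract :: ("{idom, ring_char_0}") ring_char_0
proof
  show "inj (of_nat :: nat \<Rightarrow> 'a fract)"
    by (auto simp: inj_on_def of_nat_fract eq_fract)
qed

instance fract :: ("{idom, ring_char_0}") field_char_0 ..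

lemma qq_neq_0 [simp]: "qq \<noteq> 0"
  by (simp add: qq_def Zero_fract_def eq_fract)

lemma qq_neq_1 [simp]: "qq \<noteq> 1"
  by (simp add: qq_def One_fract_def eq_fract one_pCons)

section \<open>The generating function of the specialised \<open>q\<^sub>m(t)\<close>\<close>

text \<open>In characteristic zero the equation \<open>h' = h g\<close> determines every coefficient of \<open>h\<close> from the
  previous ones.\<close>

lemma fps_linear_ode_unique:
  fixes h k g :: "'a::field_char_0 fps"
  assumes h: "fps_deriv h = h * g" and k: "fps_deriv k = k * g" and 0: "fps_nth h 0 = fps_nth k 0"
  shows "h = k"
proof (rule fps_ext)
  fix n show "fps_nth h n = fps_nth k n"
  proof (induction n rule: less_induct)
    case (less n)
    show ?case
    proof (cases n)
      case 0 with assms show ?thesis by simp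
    next
      case (Suc m)
      have "of_nat (Suc m) * fps_nth h (Suc m) = fps_nth (h * g) m"
        using arg_cong[OF h, of "\<lambda>f. fps_nth f m"] by simp
      also have "\<dots> = fps_nth (k * g) m"
        unfolding fps_mult_nth using less Suc by (intro sum.cong) auto
      also have "\<dots> = of_nat (Suc m) * fps_nth k (Suc m)"
        using arg_cong[OF k, of "\<lambda>f. fps_nth f m"] by simp
      finally show ?thesis using Suc by (simp del: of_nat_Suc)
    qed
  qed
qed

definition fps_geo :: "'a::field_char_0 \<Rightarrow> 'a fps" where
  "fps_geo c = Abs_fps (\<lambda>k. c ^ k)"

lemma fps_geo_inverse: "(1 - fps_const c * fps_X) * fps_geo c = 1"
proof (rule fps_ext)
  fix n show "fps_nth ((1 - fps_const c * fps_X) * fps_geo c) n = fps_nth 1 n"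
    by (cases n) (simp_all add: fps_geo_def left_diff_distrib mult.assoc)
qed

lemma fps_nth_geo_mult: "fps_nth (fps_geo c * fps_geo d) m = (\<Sum>j\<le>m. c ^ j * d ^ (m - j))"
  by (simp add: fps_mult_nth fps_geo_def atLeast0AtMost)

text \<open>The image of \<open>\<Sum>\<^sub>n (1 - t\<^sup>n)/n p\<^sub>n z\<^sup>n\<close>, the exponent in the generating function of the \<open>q\<^sub>n(t)\<close>, under
  \<open>p\<^sub>k \<mapsto> s\<^sup>k + a\<close>.\<close>

definition log_q :: "'a::field_char_0 \<Rightarrow> 'a \<Rightarrow> 'a \<Rightarrow> 'a fps" where
  "log_q t s a = Abs_fps (\<lambda>k. if k = 0 then 0 else (1 - t ^ k) / of_nat k * (s ^ k + a))"

definition spec_q :: "'a::field_char_0 \<Rightarrow> 'a \<Rightarrow> 'a \<Rightarrow> 'a fps" where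
  "spec_q t s a = fps_exp 1 oo log_q t s a"

lemma fps_deriv_log_q:
  "fps_deriv (log_q t s a) = fps_const s * fps_geo s - fps_const (t * s) * fps_geo (t * s)
     + fps_const a * fps_geo 1 - fps_const (t * a) * fps_geo t"
  by (rule fps_ext) (simp add: log_q_def fps_geo_def field_simps power_mult_distrib del: of_nat_Suc)

text \<open>Identifies \<open>spec_q t s a\<close> with a rational function \<open>K = R/P\<close> by comparing logarithmic derivatives:
  the hypothesis \<open>log_deriv\<close> is \<open>(log K)' = R'/R - P'/P\<close> without denominators.\<close>

lemma spec_q_eqI:
  fixes t s a :: "'a::field_char_0"
  assumes PK: "P * K = R" and K0: "fps_nth K 0 = 1"
    and log_deriv: "P * R * fps_deriv (log_q t s a) = fps_deriv R * P - fps_deriv P * R"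
    and nz: "P \<noteq> 0" "R \<noteq> 0"
  shows "spec_q t s a = K"
proof (rule fps_linear_ode_unique)
  let ?g = "fps_deriv (log_q t s a)"
  show "fps_deriv (spec_q t s a) = spec_q t s a * ?g"
    unfolding spec_q_def by (subst fps_compose_deriv) (simp_all add: log_q_def)
  have dR: "fps_deriv R = fps_deriv P * K + P * fps_deriv K"
    unfolding PK[symmetric] by (simp add: algebra_simps)
  have "(P * R) * fps_deriv K = R * (P * fps_deriv K)" by (simp add: ac_simps)
  also have "\<dots> = R * (fps_deriv R - fps_deriv P * K)" using dR by simp
  also have "\<dots> = K * (fps_deriv R * P - fps_deriv P * R)"
    unfolding PK[symmetric] by (simp add: algebra_simps)
  also have "\<dots> = (P * R) * (K * ?g)" unfolding log_deriv[symmetric] by (simp add: ac_simps)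
  finally show "fps_deriv K = K * ?g" using nz by simp
  show "fps_nth (spec_q t s a) 0 = fps_nth K 0"
    using K0 by (simp add: spec_q_def fps_compose_nth)
qed

text \<open>The rational function is \<open>((1 - tz)/(1 - z))\<^sup>2\<close>.\<close>

lemma spec_q_two:
  fixes t :: "'a::field_char_0"
  shows "spec_q t 1 1 = Abs_fps (\<lambda>m. if m = 0 then 1 else (1 - t) * (of_nat (m + 1) - t * (of_nat m - 1)))"
    (is "_ = ?K")
proof (rule spec_q_eqI)
  let ?P1 = "1 - fps_X :: 'a fps" and ?R1 = "1 - fps_const t * fps_X :: 'a fps"
  have "?P1 * (?P1 * ?K) = ?R1 * ?R1"
  proof (rule fps_ext)
    fix n
    consider "n = 0" | "n = 1" | "n = 2" | j where "n = Suc (Suc (Suc j))"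
      by (metis One_nat_def Suc_1 not0_implies_Suc)
    then show "fps_nth (?P1 * (?P1 * ?K)) n = fps_nth (?R1 * ?R1) n"
      by cases (simp_all add: left_diff_distrib mult.assoc numeral_2_eq_2, simp_all add: algebra_simps)
  qed
  then show "?P1 * ?P1 * ?K = ?R1 * ?R1" by (simp add: mult.assoc)
  have g1: "?P1 * fps_geo 1 = 1" and gt: "?R1 * fps_geo t = 1"
    using fps_geo_inverse[of 1] fps_geo_inverse[of t] by simp_all
  show "?P1 * ?P1 * (?R1 * ?R1) * fps_deriv (log_q t 1 1)
    = fps_deriv (?R1 * ?R1) * (?P1 * ?P1) - fps_deriv (?P1 * ?P1) * (?R1 * ?R1)"
  proof -
    have g: "fps_deriv (log_q t 1 1) = 2 * fps_geo 1 - 2 * fps_const t * fps_geo t"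
      unfolding fps_deriv_log_q by simp
    have "P * P * (R * R) * (2 * G - 2 * c * H) = 2 * (P * G) * (P * R * R) - 2 * c * (R * H) * (R * P * P)"
      for P R G H c :: "'a fps" by (simp add: algebra_simps)
    from this[of ?P1 ?R1 "fps_geo 1" "fps_const t" "fps_geo t"]
    have eq: "?P1 * ?P1 * (?R1 * ?R1) * fps_deriv (log_q t 1 1)
        = 2 * (?P1 * ?R1 * ?R1) - 2 * fps_const t * (?R1 * ?P1 * ?P1)"
      unfolding g g1 gt by simp
    show ?thesis unfolding eq by (simp add: algebra_simps del: fps_const_mult)
  qed
  show "?P1 * ?P1 \<noteq> 0" "?R1 * ?R1 \<noteq> 0" 
    by (auto dest: arg_cong[of _ _ "\<lambda>f. fps_nth f 0"])
  show "fps_nth ?K 0 = 1" by simp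
qed

text \<open>The rational function is \<open>(1 + tz)(1 - z) / ((1 + z)(1 - tz)) = 1 - 2(1 - t)z / ((1 + z)(1 - tz))\<close>.\<close>

lemma spec_q_super:
  fixes t :: "'a::field_char_0"
  shows "spec_q t (-1) (-1) = Abs_fps (\<lambda>m. if m = 0 then 1 else - 2 * (1 - t) * (\<Sum>j<m. (-1) ^ j * t ^ (m - 1 - j)))"
    (is "_ = ?K")
proof (rule spec_q_eqI)
  let ?X = "fps_X :: 'a fps" and ?t = "fps_const t :: 'a fps"
  have K: "?K = 1 - fps_const (2 * (1 - t)) * (?X * (fps_geo (-1) * fps_geo t))"
  proof (rule fps_ext)
    fix n show "fps_nth ?K n = fps_nth (1 - fps_const (2 * (1 - t)) * (?X * (fps_geo (-1) * fps_geo t))) n"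
      by (cases n) (simp_all add: fps_nth_geo_mult lessThan_Suc_atMost mult.assoc, simp add: left_diff_distrib)
  qed
  have g: "(1 + ?X) * fps_geo (-1) = 1" "(1 - ?X) * fps_geo 1 = 1" "(1 - ?t * ?X) * fps_geo t = 1"
     "(1 + ?t * ?X) * fps_geo (-t) = 1"
    using fps_geo_inverse[of "-1"] fps_geo_inverse[of "1"] fps_geo_inverse[of t] fps_geo_inverse[of "-t"]
    by (simp_all flip: fps_const_neg)
  have c: "fps_const (2 * (1 - t)) = 2 * (1 - ?t)"
    by (simp flip: fps_const_mult fps_const_sub add: numeral_fps_const right_diff_distrib)
  show "((1 + ?X) * (1 - ?t * ?X)) * ?K = (1 + ?t * ?X) * (1 - ?X)"
  proof -
    have "A * B * (1 - d * (?X * (G * H))) = A * B - d * ?X * (A * G) * (B * H)"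
      for A B G H d :: "'a fps" by (simp add: algebra_simps)
    from this[of "1 + ?X" "1 - ?t * ?X" "2 * (1 - ?t)" "fps_geo (-1)" "fps_geo t"]
    show ?thesis unfolding K c g by (simp add: algebra_simps)
  qed
  show "((1 + ?X) * (1 - ?t * ?X)) * ((1 + ?t * ?X) * (1 - ?X)) * fps_deriv (log_q t (-1) (-1))
    = fps_deriv ((1 + ?t * ?X) * (1 - ?X)) * ((1 + ?X) * (1 - ?t * ?X))
      - fps_deriv ((1 + ?X) * (1 - ?t * ?X)) * ((1 + ?t * ?X) * (1 - ?X))"
  proof -
    have "A * B * (C * D) * (- G + c * I - J + c * H)
        = c * (C * I) * (A * B * D) + c * (B * H) * (A * C * D) - (A * G) * (B * C * D) - (D * J) * (A * B * C)"
      for A B C D G H I J c :: "'a fps" by (simp add: algebra_simps)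
    from this[of "1 + ?X" "1 - ?t * ?X" "1 + ?t * ?X" "1 - ?X" "fps_geo (-1)" ?t "fps_geo (-t)" "fps_geo 1" "fps_geo t"]
    show ?thesis unfolding fps_deriv_log_q g by (simp flip: fps_const_neg add: algebra_simps)
  qed
  show "(1 + ?X) * (1 - ?t * ?X) \<noteq> 0" "(1 + ?t * ?X) * (1 - ?X) \<noteq> 0" 
    by (auto dest: arg_cong[of _ _ "\<lambda>f. fps_nth f 0"])
  show "fps_nth ?K 0 = 1" by simp
qed

section \<open>Polynomial functions\<close>

definition poly_fun :: "('a::field_char_0 \<Rightarrow> 'a) \<Rightarrow> bool" where
  "poly_fun f \<longleftrightarrow> (\<exists>p. \<forall>x. f x = poly p x)"

named_theorems poly_fun_intros

lemma poly_fun_const [poly_fun_intros]: "poly_fun (\<lambda>_. c)"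
  unfolding poly_fun_def by (rule exI[of _ "[:c:]"]) simp

lemma poly_fun_id [poly_fun_intros]: "poly_fun (\<lambda>x. x)"
  unfolding poly_fun_def by (rule exI[of _ "[:0,1:]"]) simp

lemma poly_fun_add [poly_fun_intros]: "poly_fun f \<Longrightarrow> poly_fun g \<Longrightarrow> poly_fun (\<lambda>x. f x + g x)"
  unfolding poly_fun_def by (metis poly_add)

lemma poly_fun_mult [poly_fun_intros]: "poly_fun f \<Longrightarrow> poly_fun g \<Longrightarrow> poly_fun (\<lambda>x. f x * g x)"
  unfolding poly_fun_def by (metis poly_mult)

lemma poly_fun_divide [poly_fun_intros]: "poly_fun f \<Longrightarrow> poly_fun (\<lambda>x. f x / c)"
  using poly_fun_mult[OF _ poly_fun_const, of f "inverse c"] by (simp add: field_simps)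

lemma poly_fun_sum [poly_fun_intros]: "(\<And>i. i \<in> A \<Longrightarrow> poly_fun (f i)) \<Longrightarrow> poly_fun (\<lambda>x. \<Sum>i\<in>A. f i x)"
  by (induction A rule: infinite_finite_induct) (auto intro: poly_fun_intros)

lemma poly_fun_prod_list [poly_fun_intros]:
  "(\<And>i. i \<in> set xs \<Longrightarrow> poly_fun (f i)) \<Longrightarrow> poly_fun (\<lambda>x. \<Prod>i\<leftarrow>xs. f i x)"
  by (induction xs) (auto intro: poly_fun_intros)

lemma poly_fun_eqI:
  assumes "poly_fun f" "poly_fun g" "\<And>N. f (of_nat N) = g (of_nat N)"
  shows "f x = g x"
proof -
  obtain p r where p: "\<And>x. f x = poly p x" and r: "\<And>x. g x = poly r x"
    using assms(1,2) unfolding poly_fun_def by blast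
  have "infinite (range (of_nat :: nat \<Rightarrow> 'a))" by (rule range_inj_infinite) (simp add: inj_on_def)
  moreover have "range of_nat \<subseteq> {x. poly (p - r) x = 0}" using assms(3) p r by auto
  ultimately have "infinite {x. poly (p - r) x = 0}" using infinite_super by blast
  then have "p - r = 0" using poly_roots_finite by blast
  then show ?thesis by (simp add: p r)
qed

text \<open>The difference of \<open>x\<^sup>d\<^sup>+\<^sup>1\<close> is \<open>(d + 1) x\<^sup>d\<close> plus lower powers, whose antidifferences are already known.\<close>

lemma power_antidifference:
  "\<exists>P :: 'a::field_char_0 poly. \<forall>x. poly P (x + 1) - poly P x = x ^ d"
proof (induction d rule: less_induct)
  case (less d)
  then obtain Q :: "nat \<Rightarrow> 'a poly" where Q: "\<And>k x. k < d \<Longrightarrow> poly (Q k) (x + 1) - poly (Q k) x = x ^ k"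
    by metis
  let ?P = "Polynomial.smult (1 / of_nat (Suc d)) (monom 1 (Suc d) - (\<Sum>k<d. Polynomial.smult (of_nat (Suc d choose k)) (Q k)))"
  have "poly ?P (x + 1) - poly ?P x = x ^ d" for x
  proof -
    have "(x + 1) ^ Suc d = (\<Sum>k\<le>Suc d. of_nat (Suc d choose k) * x ^ k)"
      by (subst binomial_ring) simp
    also have "\<dots> = (\<Sum>k<d. of_nat (Suc d choose k) * x ^ k) + of_nat (Suc d) * x ^ d + x ^ Suc d"
      by (simp add: lessThan_Suc_atMost[symmetric])
    finally have 1: "(x + 1) ^ Suc d - x ^ Suc d - (\<Sum>k<d. of_nat (Suc d choose k) * x ^ k) = of_nat (Suc d) * x ^ d"
      by simp
    have "(\<Sum>k<d. of_nat (Suc d choose k) * x ^ k)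
        = (\<Sum>k<d. of_nat (Suc d choose k) * (poly (Q k) (x + 1) - poly (Q k) x))"
      using Q by simp
    then have 2: "(\<Sum>k<d. of_nat (Suc d choose k) * poly (Q k) (x + 1)) - (\<Sum>k<d. of_nat (Suc d choose k) * poly (Q k) x)
       = (\<Sum>k<d. of_nat (Suc d choose k) * x ^ k)"
      by (simp add: right_diff_distrib sum_subtractf)
    have "poly ?P (x + 1) - poly ?P x = (1 / of_nat (Suc d)) *
       ((x + 1) ^ Suc d - x ^ Suc d - ((\<Sum>k<d. of_nat (Suc d choose k) * poly (Q k) (x + 1)) - (\<Sum>k<d. of_nat (Suc d choose k) * poly (Q k) x)))"
      by (simp add: poly_sum poly_monom right_diff_distrib del: of_nat_Suc power_Suc)
    also have "\<dots> = x ^ d" unfolding 2 1 by (simp del: of_nat_Suc)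
    finally show ?thesis .
  qed
  then show ?case by blast
qed

lemma poly_antidifference:
  fixes p :: "'a::field_char_0 poly"
  shows "\<exists>P. \<forall>x. poly P (x + 1) - poly P x = poly p x"
proof -
  obtain Q :: "nat \<Rightarrow> 'a poly" where Q: "\<And>d x. poly (Q d) (x + 1) - poly (Q d) x = x ^ d"
    using power_antidifference by metis
  let ?P = "\<Sum>i\<le>degree p. Polynomial.smult (coeff p i) (Q i)"
  have "poly ?P (x + 1) - poly ?P x = poly p x" for x
    by (simp add: poly_sum poly_altdef[of p] Q flip: sum_subtractf right_diff_distrib)
  then show ?thesis by blast
qed

text \<open>A sequence with polynomial differences is polynomial. This is how a recursion in the number of
  variables shows that the value of a Schur function is a polynomial in this number.\<close>

lemma poly_fun_of_difference:
  fixes S :: "nat \<Rightarrow> 'a::field_char_0"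
  assumes "poly_fun f" and diff: "\<And>N. S (Suc N) = S N + f (of_nat N)"
  shows "\<exists>F. poly_fun F \<and> (\<forall>N. F (of_nat N) = S N)"
proof -
  obtain p where p: "\<And>x. f x = poly p x" using assms(1) unfolding poly_fun_def by blast
  obtain P where P: "\<And>x. poly P (x + 1) - poly P x = poly p x" using poly_antidifference by blast
  have "poly (P + [:S 0 - poly P 0:]) (of_nat N) = S N" for N
  proof (induction N)
    case (Suc N)
    then show ?case using P[of "of_nat N"] by (simp add: diff p algebra_simps)
  qed simp
  then show ?thesis unfolding poly_fun_def by blast
qed

lemma poly_fun_fps_power:
  assumes "\<And>n. poly_fun (\<lambda>a. fps_nth (g a) n)"
  shows "poly_fun (\<lambda>a. fps_nth (g a ^ k) n)"
proof (induction k arbitrary: n)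
  case 0 then show ?case by (simp add: poly_fun_intros)
next
  case (Suc k) then show ?case
    unfolding power_Suc fps_mult_nth using assms by (intro poly_fun_intros)
qed

lemma poly_fun_spec_q [poly_fun_intros]: "poly_fun (\<lambda>a. fps_nth (spec_q t s a) m)"
proof -
  have "poly_fun (\<lambda>a. fps_nth (log_q t s a) n)" for n
    by (cases n) (auto simp: log_q_def intro!: poly_fun_intros)
  then show ?thesis unfolding spec_q_def fps_compose_nth
    by (intro poly_fun_intros poly_fun_fps_power)
qed


section \<open>Specialising symmetric functions\<close>

definition exponents :: "nat \<Rightarrow> nat \<Rightarrow> (nat \<Rightarrow>\<^sub>0 nat) set" where
  "exponents N d = {m. Poly_Mapping.keys m \<subseteq> {..N} \<and> (\<Sum>k\<le>N. Poly_Mapping.lookup m k) = d}"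

lemma lookup_exponents_gt: "m \<in> exponents N d \<Longrightarrow> N < k \<Longrightarrow> Poly_Mapping.lookup m k = 0"
  by (force simp: exponents_def in_keys_iff)

lemma finite_exponents [simp]: "finite (exponents N d)"
proof -
  let ?h = "\<lambda>m :: nat \<Rightarrow>\<^sub>0 nat. map (Poly_Mapping.lookup m) [0..<Suc N]"
  have inj: "inj_on ?h (exponents N d)"
  proof (rule inj_onI, rule poly_mapping_eqI)
    fix m m' k assume m: "m \<in> exponents N d" "m' \<in> exponents N d" and eq: "?h m = ?h m'"
    show "Poly_Mapping.lookup m k = Poly_Mapping.lookup m' k"
    proof (cases "k \<le> N")
      case True
      then have "k \<in> set [0..<Suc N]" by auto
      with eq show ?thesis by (simp only: map_eq_conv)
    qed (use m lookup_exponents_gt in auto)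
  qed
  have sub: "?h ` exponents N d \<subseteq> {xs. set xs \<subseteq> {..d} \<and> length xs = Suc N}"
    by (auto simp: exponents_def less_Suc_eq_le simp del: upt_Suc intro!: member_le_sum)
  have fin: "finite {xs. set xs \<subseteq> {..d} \<and> length xs = Suc N}"
    by (rule finite_lists_length_eq) simp
  show ?thesis
    by (rule finite_imageD[OF finite_subset[OF sub fin] inj])
qed

text \<open>Substitutes \<open>s z\<close> for \<open>x\<^sub>0\<close>, \<open>z\<close> for \<open>x\<^sub>1, \<dots>, x\<^sub>N\<close>, and \<open>0\<close> for all other variables. The variable
  \<open>z\<close> of the resulting power series records the degree; it keeps the sums finite, so that the
  substitution is a ring homomorphism on all series and not only on those of bounded degree.\<close>

definition specialise :: "qfield \<Rightarrow> nat \<Rightarrow> qfield mseries \<Rightarrow> qfield fps" where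
  "specialise s N f = Abs_fps (\<lambda>d. \<Sum>m\<in>exponents N d. s ^ Poly_Mapping.lookup m 0 * mcoeff f m)"

lemma specialise_add: "specialise s N (f + g) = specialise s N f + specialise s N g"
  by (rule fps_ext) (simp add: specialise_def plus_mseries_def distrib_left sum.distrib)

lemma specialise_mconst [simp]: "specialise s N (mconst c) = fps_const c"
proof (rule fps_ext)
  fix d
  have "0 \<in> exponents N d \<longleftrightarrow> d = 0" by (auto simp: exponents_def)
  moreover have "fps_nth (specialise s N (mconst c)) d
    = (\<Sum>m\<in>exponents N d. if m = 0 then c else 0)"
    unfolding specialise_def fps_nth_Abs_fps by (rule sum.cong) (auto simp: mconst_def)
  ultimately show "fps_nth (specialise s N (mconst c)) d = fps_nth (fps_const c) d"
    by (simp add: sum.delta)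
qed

lemma specialise_1 [simp]: "specialise s N 1 = 1"
  using specialise_mconst[of s N 1] by (simp add: mconst_def one_mseries_def)

lemma specialise_0 [simp]: "specialise s N 0 = 0"
  by (rule fps_ext) (simp add: specialise_def zero_mseries_def)

lemma specialise_mult: "specialise s N (f * g) = specialise s N f * specialise s N g"
proof (rule fps_ext)
  fix d
  let ?L = "\<lambda>m. Poly_Mapping.lookup m (0::nat)"
  let ?S = "\<lambda>m :: nat \<Rightarrow>\<^sub>0 nat. \<Sum>k\<le>N. Poly_Mapping.lookup m k"
  have ex: "u + v \<in> exponents N e \<longleftrightarrow> u \<in> exponents N (?S u) \<and> v \<in> exponents N (?S v) \<and> e = ?S u + ?S v" for u v e
  proof -
    have "Poly_Mapping.keys (u + v) = Poly_Mapping.keys u \<union> Poly_Mapping.keys v"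
      by (auto simp: in_keys_iff lookup_add)
    then show ?thesis by (auto simp: exponents_def lookup_add sum.distrib)
  qed
  have S: "?S u = e" if "u \<in> exponents N e" for u e using that by (simp add: exponents_def)
  have "fps_nth (specialise s N (f * g)) d
     = (\<Sum>m\<in>exponents N d. \<Sum>(u, v)\<in>splits m. (s ^ ?L u * mcoeff f u) * (s ^ ?L v * mcoeff g v))"
    unfolding specialise_def fps_nth_Abs_fps times_mseries_def mcoeff_Mseries sum_distrib_left
    by (intro sum.cong refl) (auto simp: splits_def lookup_add power_add ac_simps)
  also have "\<dots> = (\<Sum>(m, u, v)\<in>Sigma (exponents N d) splits. (s ^ ?L u * mcoeff f u) * (s ^ ?L v * mcoeff g v))"
    by (subst sum.Sigma) (auto simp: case_prod_unfold)
  also have "\<dots> = (\<Sum>(i, u, v)\<in>Sigma {0..d} (\<lambda>i. exponents N i \<times> exponents N (d - i)).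
       (s ^ ?L u * mcoeff f u) * (s ^ ?L v * mcoeff g v))"
    by (rule sum.reindex_bij_witness[where i = "\<lambda>(i, u, v). (u + v, u, v)" and j = "\<lambda>(m, u, v). (?S u, u, v)"])
      (auto simp: splits_def ex S)
  also have "\<dots> = (\<Sum>i=0..d. \<Sum>(u, v)\<in>exponents N i \<times> exponents N (d - i).
       (s ^ ?L u * mcoeff f u) * (s ^ ?L v * mcoeff g v))"
    by (subst sum.Sigma) (auto simp: case_prod_unfold)
  also have "\<dots> = fps_nth (specialise s N f * specialise s N g) d"
    unfolding fps_mult_nth specialise_def fps_nth_Abs_fps
    by (simp add: sum_product sum.cartesian_product)
  finally show "fps_nth (specialise s N (f * g)) d = fps_nth (specialise s N f * specialise s N g) d" .
qed

lemma specialise_sum: "specialise s N (\<Sum>i\<in>A. f i) = (\<Sum>i\<in>A. specialise s N (f i))"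
  by (induction A rule: infinite_finite_induct) (simp_all add: specialise_add)

lemma specialise_power_sum:
  assumes "0 < k"
  shows "specialise s N (power_sum k) = fps_const (s ^ k + of_nat N) * fps_X ^ k"
proof (rule fps_ext)
  fix d
  let ?M = "(\<lambda>i. Poly_Mapping.single i k) ` {..N}"
  have inj: "inj_on (\<lambda>i. Poly_Mapping.single i k) {..N}"
    using assms by (intro inj_onI) (metis lookup_single_eq lookup_single_not_eq neq0_conv)
  have mem: "Poly_Mapping.single i k \<in> exponents N d \<longleftrightarrow> i \<le> N \<and> d = k" for i
    using assms by (auto simp: exponents_def lookup_single when_def)
  have "fps_nth (specialise s N (power_sum k)) d
     = (\<Sum>m\<in>exponents N d. if m \<in> ?M then s ^ Poly_Mapping.lookup m 0 else 0)"
    unfolding specialise_def fps_nth_Abs_fps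
    by (rule sum.cong) (auto simp: power_sum_def mem)
  also have "\<dots> = (\<Sum>m\<in>exponents N d \<inter> ?M. s ^ Poly_Mapping.lookup m 0)"
    by (simp add: sum.inter_restrict)
  also have "\<dots> = (if d = k then s ^ k + of_nat N else 0)"
  proof (cases "d = k")
    case True
    then have "exponents N d \<inter> ?M = ?M" using mem by auto
    then have "(\<Sum>m\<in>exponents N d \<inter> ?M. s ^ Poly_Mapping.lookup m 0)
        = (\<Sum>i\<le>N. s ^ Poly_Mapping.lookup (Poly_Mapping.single i k) 0)"
      by (simp add: sum.reindex[OF inj])
    also have "\<dots> = s ^ k + of_nat N"
      by (subst sum.atMost_shift) (simp add: lookup_single)
    finally show ?thesis using True by simp
  next
    case False
    then have "exponents N d \<inter> ?M = {}" using mem by auto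
    with False show ?thesis by simp
  qed
  finally show "fps_nth (specialise s N (power_sum k)) d
      = fps_nth (fps_const (s ^ k + of_nat N) * fps_X ^ k) d"
    by simp
qed

section \<open>Branching of Schur functions\<close>

definition ssyt_upto :: "nat list \<Rightarrow> nat \<Rightarrow> (nat \<times> nat \<Rightarrow> nat) set" where
  "ssyt_upto \<nu> N = {T \<in> ssyt \<nu>. \<forall>x\<in>diagram \<nu>. T x \<le> N}"

definition schur_value :: "qfield \<Rightarrow> nat \<Rightarrow> nat list \<Rightarrow> qfield" where
  "schur_value s N \<nu> = (\<Sum>T\<in>ssyt_upto \<nu> N. s ^ card {x \<in> diagram \<nu>. T x = 0})"

lemma diagram_eq_Sigma: "diagram \<nu> = Sigma {..<length \<nu>} (\<lambda>r. {..<\<nu> ! r})"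
  by (auto simp: diagram_def)

lemma finite_diagram [simp]: "finite (diagram \<nu>)"
  by (simp add: diagram_eq_Sigma)

lemma card_diagram: "card (diagram \<nu>) = sum_list \<nu>"
  by (simp add: diagram_eq_Sigma sum_list_sum_nth atLeast0LessThan)

lemma finite_ssyt_upto [simp]: "finite (ssyt_upto \<nu> N)"
proof (rule finite_subset)
  show "ssyt_upto \<nu> N \<subseteq> PiE (diagram \<nu>) (\<lambda>_. {..N})"
    unfolding ssyt_upto_def ssyt_def PiE_def Pi_def by blast
  show "finite (PiE (diagram \<nu>) (\<lambda>_. {..N}))"
    by (rule finite_PiE) simp_all
qed

text \<open>Grouping the tableaux by their content turns the sum over monomials into a sum over tableaux.\<close>

lemma specialise_schur:
  "fps_nth (specialise s N (schur \<nu>)) (sum_list \<nu>) = schur_value s N \<nu>"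
proof -
  let ?c = "\<lambda>T k. card {x \<in> diagram \<nu>. T x = k}"
  let ?content = "\<lambda>T :: nat \<times> nat \<Rightarrow> nat. Abs_poly_mapping (?c T)"
  let ?n = "sum_list \<nu>"
  have lookup: "Poly_Mapping.lookup (?content T) = ?c T" for T
  proof (rule lookup_Abs_poly_mapping)
    have "{k. ?c T k \<noteq> 0} \<subseteq> T ` diagram \<nu>" by (auto simp: card_eq_0_iff)
    then show "finite {k. ?c T k \<noteq> 0}" by (rule finite_subset) simp
  qed
  have content_iff: "(\<forall>k. ?c T k = Poly_Mapping.lookup m k) \<longleftrightarrow> ?content T = m" for T m
    unfolding poly_mapping_eq_iff lookup fun_eq_iff ..
  have upto: "{T \<in> ssyt \<nu>. ?content T = m} = {T \<in> ssyt_upto \<nu> N. ?content T = m}"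
    if m: "m \<in> exponents N ?n" for m
  proof -
    have "T x \<le> N" if "?content T = m" "x \<in> diagram \<nu>" for T x
    proof (rule ccontr)
      assume "\<not> T x \<le> N"
      then have "?c T (T x) = 0"
        using lookup_exponents_gt[OF m, of "T x"] that(1) lookup[of T] by auto
      moreover have "finite {y \<in> diagram \<nu>. T y = T x}" by simp
      ultimately have "{y \<in> diagram \<nu>. T y = T x} = {}" by (simp only: card_0_eq)
      then show False using that(2) by blast
    qed
    then show ?thesis by (auto simp: ssyt_upto_def)
  qed
  have content_exponents: "?content T \<in> exponents N ?n" if T: "T \<in> ssyt_upto \<nu> N" for T
  proof -
    have "Poly_Mapping.keys (?content T) \<subseteq> {..N}"
      using T by (auto simp: in_keys_iff lookup card_eq_0_iff ssyt_upto_def)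
    moreover have "(\<Sum>k\<le>N. ?c T k) = card (\<Union>k\<in>{..N}. {x \<in> diagram \<nu>. T x = k})"
      by (rule card_UN_disjoint[symmetric]) auto
    moreover have "(\<Union>k\<in>{..N}. {x \<in> diagram \<nu>. T x = k}) = diagram \<nu>"
      using T by (auto simp: ssyt_upto_def)
    ultimately show ?thesis by (simp add: exponents_def lookup card_diagram)
  qed
  have "fps_nth (specialise s N (schur \<nu>)) ?n
      = (\<Sum>m\<in>exponents N ?n. \<Sum>T\<in>{T \<in> ssyt_upto \<nu> N. ?content T = m}. s ^ ?c T 0)"
    unfolding specialise_def fps_nth_Abs_fps schur_def mcoeff_Mseries content_iff
  proof (rule sum.cong[OF refl])
    fix m assume m: "m \<in> exponents N ?n"
    have "(\<Sum>T\<in>{T \<in> ssyt_upto \<nu> N. ?content T = m}. s ^ ?c T 0)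
        = (\<Sum>T\<in>{T \<in> ssyt_upto \<nu> N. ?content T = m}. s ^ Poly_Mapping.lookup m 0)"
    proof (rule sum.cong[OF refl])
      fix T assume "T \<in> {T \<in> ssyt_upto \<nu> N. ?content T = m}"
      then have "?content T = m" by simp
      then have "?c T 0 = Poly_Mapping.lookup m 0" using fun_cong[OF lookup, of T 0] by simp
      then show "s ^ ?c T 0 = s ^ Poly_Mapping.lookup m 0" by simp
    qed
    then show "s ^ Poly_Mapping.lookup m 0 * of_nat (card {T \<in> ssyt \<nu>. ?content T = m})
        = (\<Sum>T\<in>{T \<in> ssyt_upto \<nu> N. ?content T = m}. s ^ ?c T 0)"
      by (simp add: upto[OF m])
  qed
  also have "\<dots> = schur_value s N \<nu>"
    unfolding schur_value_def by (rule sum.group) (auto simp: content_exponents)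
  finally show ?thesis .
qed

definition first_part :: "nat list \<Rightarrow> nat" where
  "first_part \<nu> = (case \<nu> of [] \<Rightarrow> 0 | a # _ \<Rightarrow> a)"

lemma first_part_simps [simp]: "first_part [] = 0" "first_part (a # \<nu>) = a"
  by (simp_all add: first_part_def)

text \<open>The shapes \<open>\<kappa>\<close> with \<open>\<nu>\<^sub>1 \<ge> \<kappa>\<^sub>1 \<ge> \<nu>\<^sub>2 \<ge> \<kappa>\<^sub>2 \<ge> \<dots>\<close>, that is, those for which \<open>\<nu> / \<kappa>\<close> is a horizontal strip.
  All of them have the length of \<open>\<nu>\<close>, zero parts included: in this way the parts of \<open>\<kappa>\<close> range over
  independent intervals, and sums of products over \<open>interlacing \<nu>\<close> factor.\<close>

fun interlacing :: "nat list \<Rightarrow> nat list set" where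
  "interlacing [] = {[]}"
| "interlacing (a # \<nu>) = (\<lambda>(k, \<kappa>). k # \<kappa>) ` ({first_part \<nu>..a} \<times> interlacing \<nu>)"

lemma interlacing_iff:
  "\<kappa> \<in> interlacing \<nu> \<longleftrightarrow> length \<kappa> = length \<nu> \<and>
     (\<forall>r<length \<nu>. \<kappa> ! r \<le> \<nu> ! r \<and> (Suc r < length \<nu> \<longrightarrow> \<nu> ! Suc r \<le> \<kappa> ! r))"
proof (induction \<nu> arbitrary: \<kappa>)
  case (Cons a \<nu>)
  show ?case
  proof (cases \<kappa>)
    case (Cons k \<kappa>')
    have "first_part \<nu> \<le> k \<longleftrightarrow> (0 < length \<nu> \<longrightarrow> \<nu> ! 0 \<le> k)" by (cases \<nu>) auto
    moreover have "k # \<kappa>' \<in> interlacing (a # \<nu>) \<longleftrightarrow> first_part \<nu> \<le> k \<and> k \<le> a \<and> \<kappa>' \<in> interlacing \<nu>"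
      by auto
    ultimately show ?thesis unfolding Cons Cons.IH
      by (simp add: All_less_Suc2 del: interlacing.simps) blast
  qed auto
qed auto

lemma finite_interlacing [simp]: "finite (interlacing \<nu>)"
  by (induction \<nu>) auto

lemma interlacing_refl: "sorted_wrt (\<ge>) \<nu> \<Longrightarrow> \<nu> \<in> interlacing \<nu>"
  by (auto simp: interlacing_iff dest: sorted_wrt_nth_less[OF _ lessI])

lemma interlacing_sorted:
  assumes "\<kappa> \<in> interlacing \<nu>"
  shows "sorted_wrt (\<ge>) \<kappa>"
  using assms by (auto simp: interlacing_iff sorted_wrt_iff_nth_Suc_transp transp_def intro: order_trans)

lemma interlacing_sum_list:
  assumes "\<kappa> \<in> interlacing \<nu>" "\<kappa> \<noteq> \<nu>"
  shows "sum_list \<kappa> < sum_list \<nu>"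
proof -
  have len: "length \<kappa> = length \<nu>" and le: "\<And>r. r < length \<nu> \<Longrightarrow> \<kappa> ! r \<le> \<nu> ! r"
    using assms by (auto simp: interlacing_iff)
  obtain r where "r < length \<nu>" "\<kappa> ! r \<noteq> \<nu> ! r"
    using assms(2) len by (auto simp: list_eq_iff_nth_eq)
  with le have "r < length \<nu>" "\<kappa> ! r < \<nu> ! r" by (auto simp: order_less_le)
  then show ?thesis unfolding sum_list_sum_nth len
    by (intro sum_strict_mono_ex1) (auto simp: le)
qed

text \<open>In a tableau with entries up to \<open>N + 1\<close>, the cells with entries up to \<open>N\<close> form a shape that
  interlaces \<open>\<nu>\<close>, because two cells with entry \<open>N + 1\<close> cannot lie in one column. Conversely every
  tableau on an interlacing shape extends by the entry \<open>N + 1\<close>. The entries equal to \<open>0\<close> stay, and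
  with them the weight.\<close>

lemma schur_value_Suc:
  assumes sorted: "sorted_wrt (\<ge>) \<nu>"
  shows "schur_value s (Suc N) \<nu> = (\<Sum>\<kappa>\<in>interlacing \<nu>. schur_value s N \<kappa>)"
proof -
  define shape where "shape T = map (\<lambda>r. card {c. c < \<nu> ! r \<and> T (r, c) \<le> N}) [0..<length \<nu>]"
    for T :: "nat \<times> nat \<Rightarrow> nat"
  define extend where "extend \<kappa> T = (\<lambda>x. if x \<in> diagram \<kappa> then T x else if x \<in> diagram \<nu> then Suc N else undefined)"
    for \<kappa> and T :: "nat \<times> nat \<Rightarrow> nat"
  have down: "\<nu> ! Suc r \<le> \<nu> ! r" if "Suc r < length \<nu>" for r
    using sorted_wrt_nth_less[OF sorted lessI that] .
  have row: "T (r, c) \<le> T (r, c')"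
    if "T \<in> ssyt \<nu>" "r < length \<nu>" "c \<le> c'" "c' < \<nu> ! r" for T r c c'
    using that(3,4)
  proof (induction c' rule: dec_induct)
    case (step c')
    with that have "T (r, c') \<le> T (r, c' + 1)" by (auto simp: ssyt_def diagram_def)
    with step show ?case by simp
  qed simp
  \<comment> \<open>Rows increase weakly, so the cells counted in the definition of \<open>shape\<close> start each row.\<close>
  have nth_shape: "c < shape T ! r \<longleftrightarrow> c < \<nu> ! r \<and> T (r, c) \<le> N"
    if T: "T \<in> ssyt \<nu>" and r: "r < length \<nu>" for T r c
  proof -
    let ?A = "{c. c < \<nu> ! r \<and> T (r, c) \<le> N}"
    have fin: "finite ?A" by simp
    have initial: "{..c} \<subseteq> ?A" if "c \<in> ?A" for c
      using that row[OF T r] by (auto intro: order_trans)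
    have "?A = {..<card ?A}"
    proof (cases "?A = {}")
      case False
      have "?A = {..Max ?A}" using initial[OF Max_in[OF fin False]] Max_ge[OF fin] by blast
      then show ?thesis by (metis card_atMost lessThan_Suc_atMost)
    next
      case True
      show ?thesis unfolding True by simp
    qed
    then show ?thesis using r by (auto simp: shape_def)
  qed
  have len_shape: "length (shape T) = length \<nu>" for T by (simp add: shape_def)
  have diagram_shape: "x \<in> diagram (shape T) \<longleftrightarrow> x \<in> diagram \<nu> \<and> T x \<le> N" if "T \<in> ssyt \<nu>" for T x
    using nth_shape[OF that] by (cases x) (auto simp: diagram_def len_shape)
  have shape: "shape T \<in> interlacing \<nu>" if T: "T \<in> ssyt_upto \<nu> (Suc N)" for T
    unfolding interlacing_iff
  proof (intro conjI allI impI len_shape)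
    have T': "T \<in> ssyt \<nu>" using T by (simp add: ssyt_upto_def)
    fix r assume r: "r < length \<nu>"
    show "shape T ! r \<le> \<nu> ! r" using nth_shape[OF T' r] by (meson leI less_irrefl)
    assume r': "Suc r < length \<nu>"
    show "\<nu> ! Suc r \<le> shape T ! r"
    proof (rule leI, rule notI)
      let ?c = "shape T ! r"
      assume c: "?c < \<nu> ! Suc r"
      then have d: "(r + 1, ?c) \<in> diagram \<nu>" using r' by (simp add: diagram_def)
      then have "T (r, ?c) < T (r + 1, ?c)" using T' by (simp add: ssyt_def)
      moreover have "T (r + 1, ?c) \<le> Suc N" using T d by (simp add: ssyt_upto_def)
      ultimately show False using nth_shape[OF T' r, of ?c] c down[OF r'] by simp
    qed
  qed
  have between: "length \<kappa> = length \<nu>" "r < length \<nu> \<Longrightarrow> \<kappa> ! r \<le> \<nu> ! r"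
      "Suc r < length \<nu> \<Longrightarrow> \<nu> ! Suc r \<le> \<kappa> ! r" if "\<kappa> \<in> interlacing \<nu>" for \<kappa> r
    using that by (simp_all add: interlacing_iff)
  have sub: "diagram \<kappa> \<subseteq> diagram \<nu>" if "\<kappa> \<in> interlacing \<nu>" for \<kappa>
    using between[OF that] by (auto simp: diagram_def intro: less_le_trans)
  have left: "(r, c) \<in> diagram \<kappa>" if "(r, c + 1) \<in> diagram \<kappa>" for r c \<kappa>
    using that by (auto simp: diagram_def)
  have above: "(r, c) \<in> diagram \<kappa>" if "\<kappa> \<in> interlacing \<nu>" "(r + 1, c) \<in> diagram \<nu>" for r c \<kappa>
    using that(2) between(1)[OF that(1)] between(3)[OF that(1), of r] by (simp add: diagram_def)
  have restrict: "restrict T (diagram (shape T)) \<in> ssyt_upto (shape T) N" if T: "T \<in> ssyt_upto \<nu> (Suc N)" for T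
  proof -
    have T': "T \<in> ssyt \<nu>" using T by (simp add: ssyt_upto_def)
    let ?D = "diagram (shape T)"
    have up: "(r, c) \<in> ?D" if "(r + 1, c) \<in> ?D" for r c
      using above[OF shape[OF T]] sub[OF shape[OF T]] that by blast
    have in_\<nu>: "x \<in> diagram \<nu>" "T x \<le> N" if "x \<in> ?D" for x
      using that diagram_shape[OF T'] by blast+
    show ?thesis unfolding ssyt_upto_def ssyt_def
    proof (intro CollectI conjI allI impI ballI)
      fix r c assume d: "(r, c + 1) \<in> ?D"
      have "T (r, c) \<le> T (r, c + 1)" using in_\<nu>(1)[OF d] T' by (simp add: ssyt_def)
      then show "restrict T ?D (r, c) \<le> restrict T ?D (r, c + 1)" using d left[OF d] by simp
    next
      fix r c assume d: "(r + 1, c) \<in> ?D"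
      have "T (r, c) < T (r + 1, c)" using in_\<nu>(1)[OF d] T' by (simp add: ssyt_def)
      then show "restrict T ?D (r, c) < restrict T ?D (r + 1, c)" using d up[OF d] by simp
    next
      fix x assume "x \<in> ?D"
      then show "restrict T ?D x \<le> N" using in_\<nu>(2) by simp
    qed simp
  qed
  have extend: "extend \<kappa> T \<in> ssyt_upto \<nu> (Suc N)"
    if \<kappa>: "\<kappa> \<in> interlacing \<nu>" and T: "T \<in> ssyt_upto \<kappa> N" for \<kappa> T
  proof -
    have bound: "T x \<le> N" if "x \<in> diagram \<kappa>" for x using T that by (simp add: ssyt_upto_def)
    have T': "T \<in> ssyt \<kappa>" using T by (simp add: ssyt_upto_def)
    have "extend \<kappa> T (r, c) \<le> extend \<kappa> T (r, c + 1)" if "(r, c + 1) \<in> diagram \<nu>" for r c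
      using that left[of r c \<kappa>] left[of r c \<nu>] T' le_SucI[OF bound[of "(r, c)"]]
      by (auto simp: extend_def ssyt_def)
    moreover have "extend \<kappa> T (r, c) < extend \<kappa> T (r + 1, c)" if "(r + 1, c) \<in> diagram \<nu>" for r c
      using that above[OF \<kappa> that] T' bound[of "(r, c)"]
      by (auto simp: extend_def ssyt_def)
    moreover have "extend \<kappa> T \<in> extensional (diagram \<nu>)"
      using sub[OF \<kappa>] by (auto simp: extend_def extensional_def)
    moreover have "extend \<kappa> T x \<le> Suc N" if "x \<in> diagram \<nu>" for x
      using that le_SucI[OF bound[of x]] by (auto simp: extend_def)
    ultimately show ?thesis by (auto simp: ssyt_upto_def ssyt_def)
  qed
  have shape_extend: "shape (extend \<kappa> T) = \<kappa>"
    if \<kappa>: "\<kappa> \<in> interlacing \<nu>" and T: "T \<in> ssyt_upto \<kappa> N" for \<kappa> T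
  proof (rule nth_equalityI)
    show len: "length (shape (extend \<kappa> T)) = length \<kappa>" using \<kappa> by (simp add: len_shape interlacing_iff)
    fix r assume "r < length (shape (extend \<kappa> T))"
    then have r: "r < length \<nu>" "r < length \<kappa>" using len by (simp_all add: len_shape)
    have "(r, c) \<in> diagram \<kappa> \<longleftrightarrow> c < \<kappa> ! r" "(r, c) \<in> diagram \<nu> \<longleftrightarrow> c < \<nu> ! r" for c
      using r by (simp_all add: diagram_def)
    moreover have "T x \<le> N" if "x \<in> diagram \<kappa>" for x using T that by (simp add: ssyt_upto_def)
    ultimately have "c < \<nu> ! r \<and> extend \<kappa> T (r, c) \<le> N \<longleftrightarrow> c < \<kappa> ! r" for c
      using between(2)[OF \<kappa> r(1)] by (auto simp: extend_def)
    then have "{c. c < \<nu> ! r \<and> extend \<kappa> T (r, c) \<le> N} = {..<\<kappa> ! r}" by auto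
    then show "shape (extend \<kappa> T) ! r = \<kappa> ! r" using r by (simp add: shape_def)
  qed
  have restrict_extend: "restrict (extend \<kappa> T) (diagram \<kappa>) = T"
    if "\<kappa> \<in> interlacing \<nu>" "T \<in> ssyt_upto \<kappa> N" for \<kappa> T
    using that by (auto simp: extend_def ssyt_upto_def ssyt_def extensional_def restrict_def fun_eq_iff)
  have extend_restrict: "extend (shape T) (restrict T (diagram (shape T))) = T"
    if T: "T \<in> ssyt_upto \<nu> (Suc N)" for T
  proof
    fix x
    have T': "T \<in> ssyt \<nu>" "\<And>x. x \<in> diagram \<nu> \<Longrightarrow> T x \<le> Suc N" "\<And>x. x \<notin> diagram \<nu> \<Longrightarrow> T x = undefined"
      using T by (auto simp: ssyt_upto_def ssyt_def extensional_def)
    show "extend (shape T) (restrict T (diagram (shape T))) x = T x"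
      using diagram_shape[OF T'(1), of x] T'(2)[of x] T'(3)[of x] by (auto simp: extend_def)
  qed
  have weight: "card {x \<in> diagram (shape T). restrict T (diagram (shape T)) x = 0} = card {x \<in> diagram \<nu>. T x = 0}"
    if T: "T \<in> ssyt_upto \<nu> (Suc N)" for T
  proof -
    have "T \<in> ssyt \<nu>" using T by (simp add: ssyt_upto_def)
    from diagram_shape[OF this] show ?thesis by (intro arg_cong[of _ _ card]) auto
  qed
  have "schur_value s (Suc N) \<nu> = (\<Sum>(\<kappa>, T)\<in>Sigma (interlacing \<nu>) (\<lambda>\<kappa>. ssyt_upto \<kappa> N). s ^ card {x \<in> diagram \<kappa>. T x = 0})"
    unfolding schur_value_def
  proof (rule sum.reindex_bij_witness[where i = "\<lambda>(\<kappa>, T). extend \<kappa> T"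
          and j = "\<lambda>T. (shape T, restrict T (diagram (shape T)))"], goal_cases)
    case (1 T) then show ?case unfolding prod.case by (rule extend_restrict)
  next
    case (2 T) then show ?case using shape restrict by blast
  next
    case (3 p)
    then obtain \<kappa> T where p: "p = (\<kappa>, T)" and "\<kappa> \<in> interlacing \<nu>" "T \<in> ssyt_upto \<kappa> N" by blast
    then show ?case unfolding p prod.case by (simp only: shape_extend restrict_extend)
  next
    case (4 p) then show ?case using extend by auto
  next
    case (5 T) then show ?case unfolding prod.case by (simp only: weight)
  qed
  also have "\<dots> = (\<Sum>\<kappa>\<in>interlacing \<nu>. schur_value s N \<kappa>)"
    unfolding schur_value_def by (rule sum.Sigma[symmetric]) auto
  finally show ?thesis .
qed


section \<open>The two sides of the Frobenius formula\<close>

lemma fps_const_sum: "fps_const (\<Sum>i\<in>A. f i) = (\<Sum>i\<in>A. fps_const (f i))"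
  by (induction A rule: infinite_finite_induct) (simp_all flip: fps_const_add)

lemma specialise_log_power:
  "specialise s N (fps_nth (Abs_fps (\<lambda>k. if k = 0 then 0 else mconst ((1 - t ^ k) / of_nat k) * power_sum k) ^ j) n)
   = fps_const (fps_nth (log_q t s (of_nat N) ^ j) n) * fps_X ^ n"
proof (induction j arbitrary: n)
  case 0 then show ?case by simp
next
  case (Suc j)
  let ?G = "Abs_fps (\<lambda>k. if k = 0 then 0 else mconst ((1 - t ^ k) / of_nat k) * power_sum k)"
  let ?g = "log_q t s (of_nat N)"
  have G: "specialise s N (fps_nth ?G k) = fps_const (fps_nth ?g k) * fps_X ^ k" for k
    by (cases "k = 0") (simp_all add: specialise_mult specialise_power_sum log_q_def flip: mult.assoc)
  have "specialise s N (fps_nth (?G ^ Suc j) n)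
      = (\<Sum>i=0..n. (fps_const (fps_nth ?g i) * fps_X ^ i) * (fps_const (fps_nth (?g ^ j) (n - i)) * fps_X ^ (n - i)))"
    unfolding power_Suc fps_mult_nth specialise_sum specialise_mult G Suc.IH ..
  also have "\<dots> = (\<Sum>i=0..n. fps_const (fps_nth ?g i * fps_nth (?g ^ j) (n - i)) * fps_X ^ n)"
  proof (rule sum.cong[OF refl])
    fix i assume "i \<in> {0..n}"
    then have "fps_X ^ n = (fps_X ^ i * fps_X ^ (n - i) :: qfield fps)" by (simp flip: power_add)
    then show "(fps_const (fps_nth ?g i) * fps_X ^ i) * (fps_const (fps_nth (?g ^ j) (n - i)) * fps_X ^ (n - i))
      = fps_const (fps_nth ?g i * fps_nth (?g ^ j) (n - i)) * fps_X ^ n"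
      by (simp add: ac_simps flip: fps_const_mult)
  qed
  also have "\<dots> = fps_const (fps_nth (?g ^ Suc j) n) * fps_X ^ n"
    by (simp add: fps_mult_nth sum_distrib_right[symmetric] fps_const_sum)
  finally show ?case .
qed

lemma specialise_q_fun:
  "specialise s N (q_fun m t) = fps_const (fps_nth (spec_q t s (of_nat N)) m) * fps_X ^ m"
proof -
  have "specialise s N (q_fun m t)
    = (\<Sum>k\<le>m. fps_const (1 / fact k) * (fps_const (fps_nth (log_q t s (of_nat N) ^ k) m) * fps_X ^ m))"
    unfolding q_fun_def series_exp_def fps_nth_Abs_fps specialise_sum specialise_mult specialise_mconst
      specialise_log_power by simp
  also have "\<dots> = fps_const (\<Sum>k\<le>m. 1 / fact k * fps_nth (log_q t s (of_nat N) ^ k) m) * fps_X ^ m"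
    unfolding fps_const_sum sum_distrib_right by (intro sum.cong) (simp_all flip: mult.assoc)
  finally show ?thesis by (simp add: spec_q_def fps_compose_nth atLeast0AtMost)
qed

text \<open>Here \<open>a\<close> may be any scalar; for \<open>a = N\<close> this is the only coefficient of
  \<open>specialise s N (q_tilde \<mu>)\<close> that can be nonzero.\<close>

definition q_tilde_value :: "qfield \<Rightarrow> qfield \<Rightarrow> nat list \<Rightarrow> qfield" where
  "q_tilde_value s a \<mu> = (\<Prod>m\<leftarrow>\<mu>. qq ^ m / (qq - 1) * fps_nth (spec_q (inverse qq) s a) m)"

lemma specialise_q_tilde:
  "fps_nth (specialise s N (q_tilde \<mu>)) (sum_list \<mu>) = q_tilde_value s (of_nat N) \<mu>"
proof -
  have "specialise s N (\<Prod>m\<leftarrow>\<mu>. q_fun m (inverse qq))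
     = fps_const (\<Prod>m\<leftarrow>\<mu>. fps_nth (spec_q (inverse qq) s (of_nat N)) m) * fps_X ^ sum_list \<mu>"
    by (induction \<mu>) (simp_all add: specialise_mult specialise_q_fun power_add mult_ac flip: fps_const_mult)
  moreover have "q_tilde_value s a \<mu> = qq ^ sum_list \<mu> / (qq - 1) ^ length \<mu> *
      (\<Prod>m\<leftarrow>\<mu>. fps_nth (spec_q (inverse qq) s a) m)" for a
    by (induction \<mu>) (simp_all add: q_tilde_value_def power_add)
  ultimately show ?thesis by (simp add: q_tilde_def specialise_mult)
qed

lemma poly_fun_q_tilde_value [poly_fun_intros]: "poly_fun (\<lambda>a. q_tilde_value s a \<mu>)"
  unfolding q_tilde_value_def by (intro poly_fun_intros)

lemma q_tilde_value_two:
  assumes "\<forall>m\<in>set \<mu>. 0 < m"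
  shows "q_tilde_value 1 1 \<mu>
    = qq powi (int (sum_list \<mu>) - 2 * int (length \<mu>)) * (\<Prod>m\<leftarrow>\<mu>. 1 + qq + of_nat m * (qq - 1))"
  using assms
proof (induction \<mu>)
  case (Cons m \<mu>)
  have q: "qq - 1 \<noteq> 0" by simp
  have "qq ^ m / (qq - 1) * ((1 - inverse qq) * (of_nat (m + 1) - inverse qq * (of_nat m - 1)))
      = qq powi (int m - 2) * (1 + qq + of_nat m * (qq - 1))"
    using q by (simp add: power_int_diff field_simps power2_eq_square)
  moreover have "int (m + sum_list \<mu>) - 2 * int (Suc (length \<mu>))
      = (int m - 2) + (int (sum_list \<mu>) - 2 * int (length \<mu>))" by simp
  ultimately show ?case using Cons
    by (simp add: q_tilde_value_def spec_q_two power_int_add del: of_nat_add of_nat_Suc)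
qed (simp add: q_tilde_value_def)

lemma q_tilde_value_super:
  assumes "\<forall>m\<in>set \<mu>. 0 < m"
  shows "q_tilde_value (-1) (-1) \<mu> = (-2) ^ length \<mu> * (\<Prod>m\<leftarrow>\<mu>. qint (- qq) m)"
  using assms
proof (induction \<mu>)
  case (Cons m \<mu>)
  let ?t = "inverse qq"
  have q: "qq - 1 \<noteq> 0" by simp
  have "qq ^ (m - 1) * (\<Sum>j<m. (-1) ^ j * ?t ^ (m - 1 - j)) = (\<Sum>j<m. (-1) ^ j * qq ^ j)"
    unfolding sum_distrib_left
  proof (rule sum.cong[OF refl])
    fix j assume "j \<in> {..<m}"
    then have "qq ^ (m - 1) = qq ^ j * qq ^ (m - 1 - j)" by (simp flip: power_add)
    then show "qq ^ (m - 1) * ((-1) ^ j * ?t ^ (m - 1 - j)) = (-1) ^ j * qq ^ j"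
      by (simp add: power_inverse)
  qed
  also have "\<dots> = qint (- qq) m" unfolding qint_def by (simp flip: power_mult_distrib)
  finally have sum: "qint (- qq) m = qq ^ (m - 1) * (\<Sum>j<m. (-1) ^ j * ?t ^ (m - 1 - j))" ..
  have "qq ^ m / (qq - 1) * (- 2 * (1 - ?t) * (\<Sum>j<m. (-1) ^ j * ?t ^ (m - 1 - j)))
      = - 2 * qint (- qq) m"
  proof -
    have "qq ^ m / (qq - 1) * (1 - ?t) = qq ^ (m - 1)"
      using q Cons.prems by (cases m) (simp_all add: field_simps)
    then have "qq ^ m / (qq - 1) * (- 2 * (1 - ?t) * S) = - 2 * (qq ^ (m - 1) * S)" for S
      by (metis (no_types, lifting) mult.assoc mult.left_commute)
    then show ?thesis unfolding sum .
  qed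
  then show ?case using Cons
    by (simp add: q_tilde_value_def spec_q_super)
qed (simp add: q_tilde_value_def)

subsection \<open>Values of Schur functions\<close>

text \<open>If all entries are \<open>0\<close>, then columns have at most one cell.\<close>

lemma schur_value_0:
  assumes "sorted_wrt (\<ge>) \<nu>"
  shows "schur_value s 0 \<nu> = s ^ first_part \<nu> * of_bool (\<forall>p\<in>set (tl \<nu>). p = 0)"
proof -
  have single: "ssyt_upto \<nu> 0 \<subseteq> {restrict (\<lambda>_. 0) (diagram \<nu>)}"
    by (auto simp: ssyt_upto_def ssyt_def extensional_def fun_eq_iff)
  show ?thesis
  proof (cases "\<forall>p\<in>set (tl \<nu>). p = 0")
    case True
    have "(Suc r, c) \<notin> diagram \<nu>" for r c
      using True by (cases \<nu>) (auto simp: diagram_def all_set_conv_all_nth)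
    moreover have "(r, c) \<in> diagram \<nu>" if "(r, Suc c) \<in> diagram \<nu>" for r c
      using that by (simp add: diagram_def)
    ultimately have "restrict (\<lambda>_. 0) (diagram \<nu>) \<in> ssyt_upto \<nu> 0"
      unfolding ssyt_upto_def ssyt_def by simp
    then have "ssyt_upto \<nu> 0 = {restrict (\<lambda>_. 0) (diagram \<nu>)}"
      using single by blast
    moreover have "sum_list \<nu> = first_part \<nu>"
      using True by (cases \<nu>) (auto simp: sum_list_eq_0_iff)
    moreover have "{x \<in> diagram \<nu>. restrict (\<lambda>_. 0::nat) (diagram \<nu>) x = 0} = diagram \<nu>" by auto
    ultimately show ?thesis using True by (simp add: schur_value_def card_diagram)
  next
    case False
    then obtain a \<kappa> p where \<nu>: "\<nu> = a # \<kappa>" and p: "p \<in> set \<kappa>" "0 < p" by (cases \<nu>) auto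
    then obtain r where "r < length \<kappa>" "\<kappa> ! r = p" by (auto simp: in_set_conv_nth)
    then have r: "(Suc r, 0) \<in> diagram \<nu>" using \<nu> p by (simp add: diagram_def)
    moreover have "(r, 0) \<in> diagram \<nu>"
      using r sorted_wrt_nth_less[OF assms lessI, of r] by (auto simp: diagram_def)
    ultimately have "ssyt_upto \<nu> 0 = {}"
      by (force simp: ssyt_upto_def ssyt_def)
    with False show ?thesis by (simp add: schur_value_def)
  qed
qed

definition row_product :: "(nat \<Rightarrow> 'a) \<Rightarrow> (nat \<Rightarrow> 'a) \<Rightarrow> nat list \<Rightarrow> 'a::comm_ring_1" where
  "row_product f g \<nu> = (case \<nu> of [] \<Rightarrow> 1 | a # \<kappa> \<Rightarrow> f a * (\<Prod>p\<leftarrow>\<kappa>. g p))"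

text \<open>The factored form of the sum of \<open>\<Prod>\<^sub>i g \<kappa>\<^sub>i\<close> over the shapes \<open>\<kappa>\<close> that interlace \<open>\<nu>\<close>.\<close>

fun interval_product :: "(nat \<Rightarrow> 'a) \<Rightarrow> nat list \<Rightarrow> 'a::comm_ring_1" where
  "interval_product g [] = 1"
| "interval_product g (a # \<nu>) = (\<Sum>k=first_part \<nu>..a. g k) * interval_product g \<nu>"

lemma sum_interlacing_Cons:
  "(\<Sum>\<kappa>\<in>interlacing (a # \<nu>). F \<kappa>) = (\<Sum>k=first_part \<nu>..a. \<Sum>\<kappa>\<in>interlacing \<nu>. F (k # \<kappa>))"
  by (simp add: sum.reindex inj_on_def sum.cartesian_product case_prod_unfold)

lemma sum_interlacing_prod:
  "(\<Sum>\<kappa>\<in>interlacing \<nu>. \<Prod>p\<leftarrow>\<kappa>. g p) = interval_product g \<nu>"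
proof (induction \<nu>)
  case (Cons a \<nu>)
  have "(\<Sum>\<kappa>\<in>interlacing (a # \<nu>). \<Prod>p\<leftarrow>\<kappa>. g p)
      = (\<Sum>k=first_part \<nu>..a. g k * (\<Sum>\<kappa>\<in>interlacing \<nu>. \<Prod>p\<leftarrow>\<kappa>. g p))"
    unfolding sum_interlacing_Cons by (simp add: sum_distrib_left)
  then show ?case by (simp add: Cons sum_distrib_right)
qed simp

lemma sum_interlacing_row_product:
  "(\<Sum>\<kappa>\<in>interlacing (a # \<nu>). row_product f g \<kappa>) = (\<Sum>k=first_part \<nu>..a. f k) * interval_product g \<nu>"
  by (simp add: sum_interlacing_Cons row_product_def sum_distrib_right flip: sum_distrib_left sum_interlacing_prod
      del: interlacing.simps(2))

text \<open>The polynomial in \<open>a\<close> that interpolates \<open>schur_value s N \<nu>\<close> at \<open>a = N\<close>. It exists for weakly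
  decreasing \<open>\<nu>\<close> and is unique, as it is known at infinitely many points.\<close>

definition schur_poly :: "qfield \<Rightarrow> nat list \<Rightarrow> qfield \<Rightarrow> qfield" where
  "schur_poly s \<nu> = (SOME F. poly_fun F \<and> (\<forall>N. F (of_nat N) = schur_value s N \<nu>))"

lemma schur_value_polynomial:
  "sorted_wrt (\<ge>) \<nu> \<Longrightarrow> \<exists>F. poly_fun F \<and> (\<forall>N. F (of_nat N) = schur_value s N \<nu>)"
proof (induction "sum_list \<nu>" arbitrary: \<nu> rule: less_induct)
  case less
  let ?I = "interlacing \<nu> - {\<nu>}"
  have "\<forall>\<kappa>\<in>?I. \<exists>F. poly_fun F \<and> (\<forall>N. F (of_nat N) = schur_value s N \<kappa>)"
  proof
    fix \<kappa> assume "\<kappa> \<in> ?I"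
    then have "sum_list \<kappa> < sum_list \<nu>" "sorted_wrt (\<ge>) \<kappa>"
      using interlacing_sum_list interlacing_sorted by blast+
    then show "\<exists>F. poly_fun F \<and> (\<forall>N. F (of_nat N) = schur_value s N \<kappa>)" by (rule less.hyps)
  qed
  then obtain F where F: "\<And>\<kappa>. \<kappa> \<in> ?I \<Longrightarrow> poly_fun (F \<kappa>)"
      "\<And>\<kappa> N. \<kappa> \<in> ?I \<Longrightarrow> F \<kappa> (of_nat N) = schur_value s N \<kappa>"
    by metis
  show ?case
  proof (rule poly_fun_of_difference)
    show "poly_fun (\<lambda>x. \<Sum>\<kappa>\<in>?I. F \<kappa> x)" using F by (intro poly_fun_intros)
    show "schur_value s (Suc N) \<nu> = schur_value s N \<nu> + (\<Sum>\<kappa>\<in>?I. F \<kappa> (of_nat N))" for N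
      using F(2) less.prems by (simp add: schur_value_Suc interlacing_refl sum.remove[of _ \<nu>])
  qed
qed

lemma schur_poly:
  assumes "sorted_wrt (\<ge>) \<nu>"
  shows poly_fun_schur_poly: "poly_fun (schur_poly s \<nu>)"
    and schur_poly_of_nat: "schur_poly s \<nu> (of_nat N) = schur_value s N \<nu>"
  using someI_ex[OF schur_value_polynomial[OF assms, of s]] by (auto simp: schur_poly_def)

lemma schur_poly_branching:
  assumes "sorted_wrt (\<ge>) \<nu>"
  shows "schur_poly s \<nu> (a + 1) = (\<Sum>\<kappa>\<in>interlacing \<nu>. schur_poly s \<kappa> a)"
proof (rule poly_fun_eqI[where x = a])
  obtain p where p: "\<And>x. schur_poly s \<nu> x = poly p x"
    using poly_fun_schur_poly[OF assms] by (auto simp: poly_fun_def)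
  show "poly_fun (\<lambda>x. schur_poly s \<nu> (x + 1))"
    unfolding poly_fun_def by (rule exI[of _ "p \<circ>\<^sub>p [:1, 1:]"]) (simp add: p poly_pcompose add.commute)
  show "poly_fun (\<lambda>x. \<Sum>\<kappa>\<in>interlacing \<nu>. schur_poly s \<kappa> x)"
    by (intro poly_fun_intros poly_fun_schur_poly interlacing_sorted)
  fix N
  have "schur_poly s \<nu> (of_nat (Suc N)) = (\<Sum>\<kappa>\<in>interlacing \<nu>. schur_poly s \<kappa> (of_nat N))"
    by (simp only: schur_poly_of_nat[OF assms] schur_value_Suc[OF assms] interlacing_sorted schur_poly_of_nat cong: sum.cong)
  then show "schur_poly s \<nu> (of_nat N + 1) = (\<Sum>\<kappa>\<in>interlacing \<nu>. schur_poly s \<kappa> (of_nat N))"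
    by (simp add: add.commute)
qed

text \<open>The branching rule at \<open>a = -1\<close> reads \<open>\<Sum>\<^sub>\<kappa> schur_poly (-1) \<kappa> (-1) = schur_value (-1) 0 \<nu>\<close>, with the
  term for \<open>\<kappa> = \<nu>\<close> and further terms for smaller shapes. So it has only one solution, and the
  stated product is one: its sum over \<open>interlacing \<nu>\<close> factors, and a factor vanishes as soon as \<open>\<nu>\<close> has a
  second nonzero part. The factor \<open>2 - of_bool (k = 0)\<close> is there because the empty shape has
  value \<open>1\<close>, while all other hooks have value \<open>\<plusminus>2\<close>.\<close>

lemma schur_poly_super:
  assumes "sorted_wrt (\<ge>) \<nu>"
  shows "schur_poly (-1) \<nu> (-1)
     = row_product (\<lambda>k. (-1) ^ k * (2 - of_bool (k = 0))) (\<lambda>k. (-1) ^ k * of_bool (k \<le> 1)) \<nu>"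
  using assms
proof (induction "sum_list \<nu>" arbitrary: \<nu> rule: less_induct)
  case less
  define f g :: "nat \<Rightarrow> qfield" where "f k = (-1) ^ k * (2 - of_bool (k = 0))" and "g k = (-1) ^ k * of_bool (k \<le> 1)" for k
  have fg: "(\<lambda>k. (-1) ^ k * (2 - of_bool (k = 0))) = f" "(\<lambda>k. (-1) ^ k * of_bool (k \<le> 1)) = g"
    by (simp_all add: fun_eq_iff f_def g_def)
  have f: "(\<Sum>k\<le>a. f k) = (-1) ^ a" for a
    by (induction a) (simp_all add: f_def)
  have g: "(\<Sum>k\<le>a. g k) = of_bool (a = 0)" for a
  proof (cases a)
    case (Suc b)
    have "(\<Sum>k\<le>Suc b. g k) = 0" by (induction b) (simp_all add: g_def)
    then show ?thesis using Suc by simp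
  qed (simp add: g_def)
  have tail: "interval_product g \<kappa> = 0" if "0 < first_part \<kappa>" for \<kappa>
    using that
  proof (induction \<kappa>)
    case (Cons b \<kappa>)
    then show ?case by (cases "first_part \<kappa> = 0") (simp_all add: atLeast0AtMost g)
  qed simp
  have tail0: "interval_product g \<kappa> = 1" if "\<forall>p\<in>set \<kappa>. p = 0" for \<kappa>
    using that by (induction \<kappa>) (auto simp: first_part_def g_def split: list.splits)
  have sum: "(\<Sum>\<kappa>\<in>interlacing \<nu>. row_product f g \<kappa>) = (-1) ^ first_part \<nu> * of_bool (\<forall>p\<in>set (tl \<nu>). p = 0)"
  proof (cases \<nu>)
    case Nil then show ?thesis by (simp add: row_product_def)
  next
    case (Cons a \<kappa>)
    show ?thesis
    proof (cases "first_part \<kappa> = 0")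
      case True
      then have "\<forall>p\<in>set \<kappa>. p = 0" using less.prems Cons by (cases \<kappa>) auto
      then show ?thesis using True unfolding Cons sum_interlacing_row_product
        by (simp add: tail0 f atLeast0AtMost)
    next
      case False
      then have "\<not> (\<forall>p\<in>set \<kappa>. p = 0)" by (cases \<kappa>) auto
      then show ?thesis using False unfolding Cons sum_interlacing_row_product
        by (simp add: tail)
    qed
  qed
  have "schur_poly (-1) \<nu> 0 = schur_value (-1) 0 \<nu>"
    using schur_poly_of_nat[OF less.prems, of "-1" 0] by simp
  then have "(\<Sum>\<kappa>\<in>interlacing \<nu>. schur_poly (-1) \<kappa> (-1)) = (\<Sum>\<kappa>\<in>interlacing \<nu>. row_product f g \<kappa>)"
    using schur_poly_branching[OF less.prems, of "-1" "-1"] by (simp add: sum schur_value_0[OF less.prems])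
  moreover have "(\<Sum>\<kappa>\<in>interlacing \<nu> - {\<nu>}. schur_poly (-1) \<kappa> (-1)) = (\<Sum>\<kappa>\<in>interlacing \<nu> - {\<nu>}. row_product f g \<kappa>)"
  proof (rule sum.cong[OF refl])
    fix \<kappa> assume "\<kappa> \<in> interlacing \<nu> - {\<nu>}"
    then have "sum_list \<kappa> < sum_list \<nu>" "sorted_wrt (\<ge>) \<kappa>"
      using interlacing_sum_list interlacing_sorted by blast+
    then show "schur_poly (-1) \<kappa> (-1) = row_product f g \<kappa>" by (rule less.hyps[unfolded fg])
  qed
  ultimately have "schur_poly (-1) \<nu> (-1) = row_product f g \<nu>"
    using interlacing_refl[OF less.prems] by (simp add: sum.remove[of _ \<nu>])
  then show ?case unfolding fg .
qed

lemma schur_poly_two: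
  assumes "sorted_wrt (\<ge>) (a # \<nu>)"
  shows "schur_poly 1 (a # \<nu>) 1 = of_nat (a - first_part \<nu> + 1) * of_bool (\<forall>p\<in>set (tl \<nu>). p = 0)"
proof -
  define g :: "nat \<Rightarrow> qfield" where "g k = of_bool (k = 0)" for k
  have le: "first_part \<nu> \<le> a" using assms by (cases \<nu>) auto
  have row: "schur_poly 1 \<kappa> 0 = row_product (\<lambda>_. 1) g \<kappa>" if "sorted_wrt (\<ge>) \<kappa>" for \<kappa>
  proof -
    have "schur_poly 1 \<kappa> 0 = schur_value 1 0 \<kappa>" using schur_poly_of_nat[OF that, of 1 0] by simp
    also have "\<dots> = of_bool (\<forall>p\<in>set (tl \<kappa>). p = 0)" by (simp add: schur_value_0[OF that])
    also have "\<dots> = (\<Prod>p\<leftarrow>tl \<kappa>. g p)"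
      by (induction "tl \<kappa>" arbitrary: \<kappa>) (auto simp: g_def dest!: sym[of "_ # _"], metis list.sel(3))
    also have "\<dots> = row_product (\<lambda>_. 1) g \<kappa>" by (cases \<kappa>) (simp_all add: row_product_def)
    finally show ?thesis .
  qed
  have "interval_product g \<nu> = of_bool (\<forall>p\<in>set (tl \<nu>). p = 0)"
  proof (induction \<nu>)
    case (Cons b \<nu>)
    have "(\<Sum>k=first_part \<nu>..b. g k) = of_bool (first_part \<nu> = 0)"
      by (simp add: g_def sum.delta)
    then show ?case using Cons by (cases \<nu>) auto
  qed simp
  moreover have "schur_poly 1 (a # \<nu>) (0 + 1) = (\<Sum>\<kappa>\<in>interlacing (a # \<nu>). row_product (\<lambda>_. 1) g \<kappa>)"
    unfolding schur_poly_branching[OF assms] by (intro sum.cong refl row interlacing_sorted)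
  ultimately show ?thesis using le by (simp add: sum_interlacing_row_product Suc_diff_le del: interlacing.simps)
qed

lemma finite_partitions_of: "finite (partitions_of n)"
proof (rule finite_subset)
  show "partitions_of n \<subseteq> {xs. set xs \<subseteq> {..n} \<and> length xs \<le> n}"
  proof safe
    fix \<nu> assume "\<nu> \<in> partitions_of n"
    then have pos: "\<forall>p\<in>set \<nu>. 0 < p" and sum: "sum_list \<nu> = n" by (auto simp: partitions_of_def)
    show "p \<le> n" if "p \<in> set \<nu>" for p using member_le_sum_list[OF that] sum by simp
    have "length \<nu> \<le> sum_list \<nu>" using pos by (induction \<nu>) auto
    with sum show "length \<nu> \<le> n" by simp
  qed
qed (rule finite_lists_length_le, simp)

text \<open>Both sides are polynomials in \<open>a\<close>, and for natural numbers \<open>a\<close> the equation is the image of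
  Frobenius' formula under \<open>specialise\<close>.\<close>

lemma frobenius_specialised:
  assumes \<mu>: "\<mu> \<in> partitions_of n"
    and frob: "q_tilde \<mu> = (\<Sum>\<nu>\<in>partitions_of n. mconst (c \<nu>) * schur \<nu>)"
  shows "q_tilde_value s a \<mu> = (\<Sum>\<nu>\<in>partitions_of n. c \<nu> * schur_poly s \<nu> a)"
proof (rule poly_fun_eqI[where x = a])
  have sorted: "sorted_wrt (\<ge>) \<nu>" and size: "sum_list \<nu> = n" if "\<nu> \<in> partitions_of n" for \<nu>
    using that by (auto simp: partitions_of_def)
  show "poly_fun (\<lambda>a. q_tilde_value s a \<mu>)" by (rule poly_fun_intros)
  show "poly_fun (\<lambda>a. \<Sum>\<nu>\<in>partitions_of n. c \<nu> * schur_poly s \<nu> a)"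
    by (intro poly_fun_intros poly_fun_schur_poly sorted)
  fix N
  have "q_tilde_value s (of_nat N) \<mu> = fps_nth (specialise s N (q_tilde \<mu>)) n"
    using specialise_q_tilde[of s N \<mu>] size[OF \<mu>] by simp
  also have "\<dots> = (\<Sum>\<nu>\<in>partitions_of n. c \<nu> * fps_nth (specialise s N (schur \<nu>)) n)"
    unfolding frob by (simp add: specialise_sum specialise_mult fps_sum_nth)
  also have "\<dots> = (\<Sum>\<nu>\<in>partitions_of n. c \<nu> * schur_poly s \<nu> (of_nat N))"
    using specialise_schur[of s N] size schur_poly_of_nat[OF sorted] by (intro sum.cong refl) auto
  finally show "q_tilde_value s (of_nat N) \<mu> = (\<Sum>\<nu>\<in>partitions_of n. c \<nu> * schur_poly s \<nu> (of_nat N))" .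
qed


section \<open>Representations of the Hecke algebra from matrices\<close>

lemma free_alg_simps [simp]:
  "carrier (free_alg n) = {f. \<forall>w\<in>Poly_Mapping.keys f. set (letters w) \<subseteq> {1..<n}}"
  "x \<otimes>\<^bsub>free_alg n\<^esub> y = x * y" "\<one>\<^bsub>free_alg n\<^esub> = 1" "\<zero>\<^bsub>free_alg n\<^esub> = 0" "x \<oplus>\<^bsub>free_alg n\<^esub> y = x + y"
  by (simp_all add: free_alg_def)

lemma free_alg_add_closed:
  "f \<in> carrier (free_alg n) \<Longrightarrow> g \<in> carrier (free_alg n) \<Longrightarrow> f + g \<in> carrier (free_alg n)"
  using Poly_Mapping.keys_add[of f g] by auto

lemma free_alg_mult_closed:
  assumes "f \<in> carrier (free_alg n)" "g \<in> carrier (free_alg n)"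
  shows "f * g \<in> carrier (free_alg n)"
  using Poly_Mapping.keys_mult[of f g] assms by (force simp: plus_gword_def)

lemma free_alg_uminus_closed: "f \<in> carrier (free_alg n) \<Longrightarrow> - f \<in> carrier (free_alg n)"
  by simp

lemma ring_free_alg: "ring (free_alg n)"
proof (rule ringI)
  show "abelian_group (free_alg n)"
  proof (rule abelian_groupI)
    fix f g assume "f \<in> carrier (free_alg n)" "g \<in> carrier (free_alg n)"
    then show "f \<oplus>\<^bsub>free_alg n\<^esub> g \<in> carrier (free_alg n)"
      unfolding free_alg_simps(5) by (rule free_alg_add_closed)
  next
    fix f assume "f \<in> carrier (free_alg n)"
    then have "- f \<in> carrier (free_alg n)" by (rule free_alg_uminus_closed)
    then show "\<exists>g\<in>carrier (free_alg n). g \<oplus>\<^bsub>free_alg n\<^esub> f = \<zero>\<^bsub>free_alg n\<^esub>"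
      by (intro bexI[of _ "- f"]) simp_all
  qed (simp_all add: ac_simps)
  show "Group.monoid (free_alg n)"
  proof (rule monoidI)
    fix f g assume "f \<in> carrier (free_alg n)" "g \<in> carrier (free_alg n)"
    then show "f \<otimes>\<^bsub>free_alg n\<^esub> g \<in> carrier (free_alg n)"
      unfolding free_alg_simps(2) by (rule free_alg_mult_closed)
  qed (simp_all add: mult.assoc zero_gword_def)
qed (simp_all add: distrib_left distrib_right)

lemma fgen_carrier: "i \<in> {1..<n} \<Longrightarrow> fgen i \<in> carrier (free_alg n)"
  by (simp add: fgen_def)

lemma fconst_carrier: "fconst c \<in> carrier (free_alg n)"
  by (simp add: fconst_def zero_gword_def)

lemma free_alg_minus_closed:
  assumes "f \<in> carrier (free_alg n)" "g \<in> carrier (free_alg n)"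
  shows "f - g \<in> carrier (free_alg n)"
  using free_alg_add_closed[OF assms(1) free_alg_uminus_closed[OF assms(2)]] by simp

lemma hecke_relations_carrier: "hecke_relations n \<subseteq> carrier (free_alg n)"
  unfolding hecke_relations_def
  by (auto simp del: free_alg_simps
      intro!: free_alg_minus_closed free_alg_mult_closed free_alg_add_closed fgen_carrier fconst_carrier)

lemma hecke_ideal: "ideal (hecke_ideal n) (free_alg n)"
  unfolding hecke_ideal_def by (intro ring.genideal_ideal ring_free_alg hecke_relations_carrier)

lemma hecke_class_hom: "hecke_class n \<in> Ring.ring_hom (free_alg n) (hecke n)"
proof -
  have "hecke_class n = a_r_coset (free_alg n) (hecke_ideal n)" by (simp add: hecke_class_def[abs_def])
  then show ?thesis unfolding hecke_def using ideal.rcos_ring_hom[OF hecke_ideal] by simp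
qed

lemma carrier_hecke: "carrier (hecke n) = hecke_class n ` carrier (free_alg n)"
  by (auto simp: hecke_def FactRing_def A_RCOSETS_def' hecke_class_def)

lemma hecke_gen_carrier: "i \<in> {1..<n} \<Longrightarrow> hecke_gen n i \<in> carrier (hecke n)"
  unfolding carrier_hecke hecke_gen_def using fgen_carrier by blast

definition word_mat :: "nat \<Rightarrow> (nat \<Rightarrow> qfield mat) \<Rightarrow> nat list \<Rightarrow> qfield mat" where
  "word_mat d A w = foldr (\<lambda>i X. A i * X) w (1\<^sub>m d)"

lemma word_mat_carrier:
  assumes A: "\<And>i. A i \<in> carrier_mat d d"
  shows "word_mat d A w \<in> carrier_mat d d"
proof (induction w)
  case (Cons i w)
  then show ?case using mult_carrier_mat[OF A[of i]] by (simp add: word_mat_def)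
qed (simp add: word_mat_def)

lemma word_mat_append:
  assumes A: "\<And>i. A i \<in> carrier_mat d d"
  shows "word_mat d A (v @ w) = word_mat d A v * word_mat d A w"
proof (induction v)
  case Nil
  then show ?case using word_mat_carrier[of A d w, OF A] by (simp add: word_mat_def)
next
  case (Cons i v)
  then show ?case
    using assoc_mult_mat[OF A[of i] word_mat_carrier[of A d v, OF A] word_mat_carrier[of A d w, OF A]]
    by (simp add: word_mat_def)
qed

definition eval_mat :: "nat \<Rightarrow> (nat \<Rightarrow> qfield mat) \<Rightarrow> free_elt \<Rightarrow> qfield mat" where
  "eval_mat d A f = mat d d (\<lambda>rs. \<Sum>w\<in>Poly_Mapping.keys f. Poly_Mapping.lookup f w * word_mat d A (letters w) $$ rs)"

lemma eval_mat_carrier [simp]: "eval_mat d A f \<in> carrier_mat d d"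
  by (simp add: eval_mat_def)

lemma eval_mat_dim [simp]: "dim_row (eval_mat d A f) = d" "dim_col (eval_mat d A f) = d"
  by (simp_all add: eval_mat_def)

lemma eval_mat_add: "eval_mat d A (f + g) = eval_mat d A f + eval_mat d A g"
proof (rule eq_matI)
  fix r s assume "r < dim_row (eval_mat d A f + eval_mat d A g)" "s < dim_col (eval_mat d A f + eval_mat d A g)"
  then have "r < d" "s < d" by (simp_all add: eval_mat_def)
  then show "eval_mat d A (f + g) $$ (r, s) = (eval_mat d A f + eval_mat d A g) $$ (r, s)"
    using setsum_keys_plus_distrib[of "\<lambda>w c. c * word_mat d A (letters w) $$ (r, s)" f g]
    by (simp add: eval_mat_def distrib_right)
qed (simp_all add: eval_mat_def)

lemma eval_mat_single:
  assumes "\<And>i. A i \<in> carrier_mat d d"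
  shows "eval_mat d A (Poly_Mapping.single w c) = c \<cdot>\<^sub>m word_mat d A (letters w)"
  using word_mat_carrier[of A d "letters w", OF assms]
  by (intro eq_matI) (auto simp: eval_mat_def)

lemma eval_mat_0: "eval_mat d A 0 = 0\<^sub>m d d"
  by (rule eq_matI) (auto simp: eval_mat_def)

lemma eval_mat_1: "(\<And>i. A i \<in> carrier_mat d d) \<Longrightarrow> eval_mat d A 1 = 1\<^sub>m d"
proof -
  assume A: "\<And>i. A i \<in> carrier_mat d d"
  have "eval_mat d A 1 = 1 \<cdot>\<^sub>m word_mat d A (letters 0)"
    using eval_mat_single[of A d 0 1, OF A] by simp
  also have "\<dots> = 1\<^sub>m d" by (rule eq_matI) (simp_all add: zero_gword_def word_mat_def)
  finally show ?thesis .
qed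

lemma poly_mapping_add_single_induct:
  assumes "P 0" and "\<And>f w c. P f \<Longrightarrow> P (f + Poly_Mapping.single w c)"
  shows "P f"
proof (induction f rule: update_induct)
  case const then show ?case using assms(1) by simp
next
  case (update f k v)
  have "Poly_Mapping.update k v f = f + Poly_Mapping.single k v"
    using update by (intro poly_mapping_eqI) (auto simp: lookup_update lookup_add lookup_single in_keys_iff)
  with assms(2) update show ?case by simp
qed

lemma eval_mat_mult:
  assumes A: "\<And>i. A i \<in> carrier_mat d d"
  shows "eval_mat d A (f * g) = eval_mat d A f * eval_mat d A g"
proof (induction f rule: poly_mapping_add_single_induct)
  case 1 show ?case by (simp add: eval_mat_0 left_mult_zero_mat[OF eval_mat_carrier])
next
  case (2 f v b)
  have single: "eval_mat d A (Poly_Mapping.single v b * g) = eval_mat d A (Poly_Mapping.single v b) * eval_mat d A g"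
  proof (induction g rule: poly_mapping_add_single_induct)
    case 1 show ?case by (simp add: eval_mat_0 right_mult_zero_mat[OF eval_mat_carrier])
  next
    case (2 g w c)
    have "eval_mat d A (Poly_Mapping.single v b * Poly_Mapping.single w c)
        = eval_mat d A (Poly_Mapping.single v b) * eval_mat d A (Poly_Mapping.single w c)"
    proof -
      let ?V = "word_mat d A (letters v)" and ?W = "word_mat d A (letters w)"
      have V: "?V \<in> carrier_mat d d" and W: "?W \<in> carrier_mat d d"
        by (rule word_mat_carrier[OF A])+
      have "(b \<cdot>\<^sub>m ?V) * (c \<cdot>\<^sub>m ?W) = b \<cdot>\<^sub>m (c \<cdot>\<^sub>m (?V * ?W))"
        using V W by (simp add: mult_smult_assoc_mat[OF V, of _ d] mult_smult_distrib[OF V W])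
      also have "\<dots> = (b * c) \<cdot>\<^sub>m (?V * ?W)" by (rule eq_matI) auto
      finally show ?thesis
        by (simp add: mult_single eval_mat_single[OF A] plus_gword_def word_mat_append[OF A])
    qed
    then show ?case using 2
      by (simp add: distrib_left eval_mat_add mult_add_distrib_mat[of _ d d _ d])
  qed
  then show ?case using 2
    by (simp add: distrib_right eval_mat_add add_mult_distrib_mat[of _ d d _ _ d])
qed

lemma eval_mat_fgen:
  assumes A: "\<And>i. A i \<in> carrier_mat d d"
  shows "eval_mat d A (fgen i) = A i"
  using A[of i] by (intro eq_matI) (auto simp: fgen_def eval_mat_single[OF A] word_mat_def right_mult_one_mat[OF A])

lemma eval_mat_fconst: "(\<And>i. A i \<in> carrier_mat d d) \<Longrightarrow> eval_mat d A (fconst c) = c \<cdot>\<^sub>m 1\<^sub>m d"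
  by (simp add: fconst_def eval_mat_single zero_gword_def word_mat_def)

lemma eval_mat_diff_eq_0:
  assumes "eval_mat d A f = eval_mat d A g"
  shows "eval_mat d A (f - g) = 0\<^sub>m d d"
proof -
  have eq: "eval_mat d A (f - g) + eval_mat d A g = eval_mat d A g"
    using eval_mat_add[of d A "f - g" g] assms by simp
  show ?thesis
  proof (rule eq_matI)
    fix r s assume "r < dim_row (0\<^sub>m d d :: qfield mat)" "s < dim_col (0\<^sub>m d d :: qfield mat)"
    then have rs: "r < d" "s < d" by simp_all
    have "(eval_mat d A (f - g) + eval_mat d A g) $$ (r, s) = eval_mat d A g $$ (r, s)"
      using eq by simp
    moreover have "(eval_mat d A (f - g) + eval_mat d A g) $$ (r, s)
       = eval_mat d A (f - g) $$ (r, s) + eval_mat d A g $$ (r, s)"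
      using rs eval_mat_carrier[of d A g] by (intro index_add_mat(1)) auto
    ultimately show "eval_mat d A (f - g) $$ (r, s) = 0\<^sub>m d d $$ (r, s)" using rs by simp
  qed (simp_all add: eval_mat_def)
qed

text \<open>The universal property of the presentation: evaluation of words at the matrices \<open>A i\<close> is a
  homomorphism on the free algebra, the relations put the generators of the ideal into its kernel, and
  so it is constant on the cosets that are the elements of the Hecke algebra.\<close>

lemma hecke_rep_from_matrices:
  assumes A: "\<And>i. A i \<in> carrier_mat d d"
    and commute: "\<And>i j. i \<in> {1..<n} \<Longrightarrow> j \<in> {1..<n} \<Longrightarrow> i + 1 < j \<Longrightarrow> A i * A j = A j * A i"
    and braid: "\<And>i. i \<in> {1..<n} \<Longrightarrow> i + 1 \<in> {1..<n} \<Longrightarrow> A i * A (i + 1) * A i = A (i + 1) * A i * A (i + 1)"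
    and quadratic: "\<And>i. i \<in> {1..<n} \<Longrightarrow> A i * A i = (qq - 1) \<cdot>\<^sub>m A i + qq \<cdot>\<^sub>m 1\<^sub>m d"
  shows "\<exists>\<rho>. hecke_rep n d \<rho> \<and> (\<forall>i\<in>{1..<n}. \<rho> (hecke_gen n i) = A i)"
proof -
  let ?R = "free_alg n" and ?M = "ring_mat TYPE(qfield) d ()" and ?I = "hecke_ideal n"
  let ?ev = "eval_mat d A"
  interpret R: ring ?R by (rule ring_free_alg)
  interpret M: ring ?M by (rule ring_mat)
  interpret I: ideal ?I ?R by (rule hecke_ideal)
  interpret ev: ring_hom_ring ?R ?M ?ev
    by unfold_locales
      (rule ring_hom_memI, auto simp: ring_mat_simps eval_mat_add eval_mat_mult[OF A] eval_mat_1[OF A])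
  have "hecke_relations n \<subseteq> a_kernel ?R ?M ?ev"
  proof
    fix x assume x: "x \<in> hecke_relations n"
    have ev0: "?ev x = 0\<^sub>m d d"
      using x unfolding hecke_relations_def
    proof (elim UnE CollectE exE conjE)
      fix i j assume "x = fgen i * fgen j - fgen j * fgen i" "i \<in> {1..<n}" "j \<in> {1..<n}" "i + 1 < j \<or> j + 1 < i"
      then show ?thesis
        using commute[of i j] commute[of j i]
        by (auto intro!: eval_mat_diff_eq_0 simp: eval_mat_mult[OF A] eval_mat_fgen[OF A])
    next
      fix i assume "x = fgen i * fgen (i + 1) * fgen i - fgen (i + 1) * fgen i * fgen (i + 1)"
        "i \<in> {1..<n}" "i + 1 \<in> {1..<n}"
      then show ?thesis using braid[of i]
        by (auto intro!: eval_mat_diff_eq_0 simp: eval_mat_mult[OF A] eval_mat_fgen[OF A])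
    next
      fix i assume "x = fgen i * fgen i - (fconst (qq - 1) * fgen i + fconst qq)" "i \<in> {1..<n}"
      moreover have "(c \<cdot>\<^sub>m 1\<^sub>m d) * A i = c \<cdot>\<^sub>m A i" for c i
        using A[of i] by (simp add: mult_smult_assoc_mat[of _ d d _ d])
      ultimately show ?thesis using quadratic[of i]
        by (auto intro!: eval_mat_diff_eq_0
            simp: eval_mat_mult[OF A] eval_mat_fgen[OF A] eval_mat_add eval_mat_fconst[OF A])
    qed
    show "x \<in> a_kernel ?R ?M ?ev"
      unfolding a_kernel_def' mem_Collect_eq ring_mat_simps
      by (intro conjI subsetD[OF hecke_relations_carrier x] ev0)
  qed
  then have sub: "?I \<subseteq> a_kernel ?R ?M ?ev"
    unfolding hecke_ideal_def by (intro R.genideal_minimal ev.kernel_is_ideal)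
  have ev_I: "?ev i = 0\<^sub>m d d" if "i \<in> ?I" for i
    using subsetD[OF sub that] unfolding a_kernel_def' mem_Collect_eq ring_mat_simps by blast
  define \<rho> where "\<rho> X = the_elem (?ev ` X)" for X
  have \<rho>: "\<rho> (hecke_class n f) = ?ev f" if f: "f \<in> carrier ?R" for f
  proof -
    have "0 \<in> ?I" using I.zero_closed by simp
    moreover have "?ev (i + f) = ?ev f" if "i \<in> ?I" for i
      using ev_I[OF that] by (simp add: eval_mat_add)
    ultimately have "?ev ` hecke_class n f = {?ev f}"
      unfolding hecke_class_def a_r_coset_def' by (auto intro!: image_eqI[of _ _ "0 + f"])
    then show ?thesis by (simp add: \<rho>_def)
  qed
  note cls = hecke_class_hom[of n]
  have "\<rho> \<in> Ring.ring_hom (hecke n) ?M"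
  proof (rule ring_hom_memI)
    fix X Y assume "X \<in> carrier (hecke n)" "Y \<in> carrier (hecke n)"
    then obtain f g where f: "f \<in> carrier ?R" "X = hecke_class n f" and g: "g \<in> carrier ?R" "Y = hecke_class n g"
      unfolding carrier_hecke by blast
    show "\<rho> (X \<otimes>\<^bsub>hecke n\<^esub> Y) = \<rho> X \<otimes>\<^bsub>?M\<^esub> \<rho> Y"
      using \<rho>[OF R.m_closed[OF f(1) g(1)]] \<rho>[OF f(1)] \<rho>[OF g(1)] ring_hom_mult[OF cls f(1) g(1)]
      unfolding f(2) g(2) by (simp add: ring_mat_simps eval_mat_mult[OF A])
    show "\<rho> (X \<oplus>\<^bsub>hecke n\<^esub> Y) = \<rho> X \<oplus>\<^bsub>?M\<^esub> \<rho> Y"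
      using \<rho>[OF R.a_closed[OF f(1) g(1)]] \<rho>[OF f(1)] \<rho>[OF g(1)] ring_hom_add[OF cls f(1) g(1)]
      unfolding f(2) g(2) by (simp add: ring_mat_simps eval_mat_add)
  next
    fix X assume "X \<in> carrier (hecke n)"
    then show "\<rho> X \<in> carrier ?M" unfolding carrier_hecke using \<rho> by (auto simp: ring_mat_simps)
  next
    show "\<rho> \<one>\<^bsub>hecke n\<^esub> = \<one>\<^bsub>?M\<^esub>"
      using \<rho>[OF R.one_closed] ring_hom_one[OF cls] by (simp add: ring_mat_simps eval_mat_1[OF A])
  qed
  moreover have "\<rho> (hecke_class n (fconst c)) = c \<cdot>\<^sub>m 1\<^sub>m d" for c
    using \<rho>[OF fconst_carrier] by (simp add: eval_mat_fconst[OF A])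
  moreover have "\<rho> (hecke_gen n i) = A i" if "i \<in> {1..<n}" for i
    using \<rho>[OF fgen_carrier[OF that]] by (simp add: hecke_gen_def eval_mat_fgen[OF A])
  ultimately show ?thesis unfolding hecke_rep_def by blast
qed

section \<open>The operators \<open>\<pi>\<^sub>i\<close>\<close>

text \<open>The operator \<open>\<pi>\<close> maps \<open>v\<^sub>k \<otimes> v\<^sub>l\<close> to \<open>swap_coeff a k l\<close> times \<open>v\<^sub>l \<otimes> v\<^sub>k\<close> plus \<open>stay_coeff a k l\<close> times
  \<open>v\<^sub>k \<otimes> v\<^sub>l\<close>. For \<open>k = l\<close> the two tensors coincide, and the whole coefficient is counted as staying.\<close>

definition swap_coeff :: "nat \<Rightarrow> nat \<Rightarrow> nat \<Rightarrow> qfield" where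
  "swap_coeff a k l = (if k = l then 0 else (if a < k \<and> a < l then -1 else 1) * (if k < l then 1 else qq))"

definition stay_coeff :: "nat \<Rightarrow> nat \<Rightarrow> nat \<Rightarrow> qfield" where
  "stay_coeff a k l = (if k < l then qq - 1 else if k = l then (if k \<le> a then qq else -1) else 0)"

definition swap_at :: "nat \<Rightarrow> nat list \<Rightarrow> nat list" where
  "swap_at i u = u[i - 1 := u ! i, i := u ! (i - 1)]"

text \<open>The matrix of \<open>\<pi>\<^sub>i\<close>, whose row index is the argument, acting on column vectors, here written as
  functions on words.\<close>

definition pi_op :: "nat \<Rightarrow> nat \<Rightarrow> (nat list \<Rightarrow> qfield) \<Rightarrow> nat list \<Rightarrow> qfield" where
  "pi_op a i f u = swap_coeff a (u ! (i - 1)) (u ! i) * f (swap_at i u)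
                 + stay_coeff a (u ! (i - 1)) (u ! i) * f u"

lemma length_swap_at [simp]: "length (swap_at i u) = length u"
  by (simp add: swap_at_def)

lemma nth_swap_at:
  assumes "1 \<le> i" "i < length u"
  shows "swap_at i u ! j = (if j = i then u ! (i - 1) else if j = i - 1 then u ! i else u ! j)"
  using assms by (simp add: swap_at_def nth_list_update)

lemma pi_word_coeff_eq:
  assumes i: "1 \<le> i" "i < length u" and len: "length v = length u"
  shows "pi_word_coeff a i u v = swap_coeff a (u ! (i - 1)) (u ! i) * of_bool (v = swap_at i u)
      + stay_coeff a (u ! (i - 1)) (u ! i) * of_bool (v = u)"
proof -
  let ?k = "u ! (i - 1)" and ?l = "u ! i"
  define rest where "rest \<longleftrightarrow> (\<forall>j<length u. j \<noteq> i - 1 \<and> j \<noteq> i \<longrightarrow> v ! j = u ! j)"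
  have two: "(\<forall>j<length u. v ! j = (if j = i then y else if j = i - 1 then x else u ! j))
      \<longleftrightarrow> v ! (i - 1) = x \<and> v ! i = y \<and> rest" (is "?all \<longleftrightarrow> _") for x y
  proof
    assume all: ?all
    have "i - 1 < length u" "i - 1 \<noteq> i" using i by auto
    then have "v ! (i - 1) = x" using all by (metis (full_types))
    moreover have "v ! i = y" using all i(2) by simp
    moreover have rest unfolding rest_def using all by simp
    ultimately show "v ! (i - 1) = x \<and> v ! i = y \<and> rest" by blast
  next
    assume "v ! (i - 1) = x \<and> v ! i = y \<and> rest"
    then show ?all unfolding rest_def by simp
  qed
  have swap: "v = swap_at i u \<longleftrightarrow> v ! (i - 1) = ?l \<and> v ! i = ?k \<and> rest"
    unfolding two[symmetric] using i len by (simp add: list_eq_iff_nth_eq nth_swap_at)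
  have "(if j = i then ?l else if j = i - 1 then ?k else u ! j) = u ! j" for j by simp
  then have stay: "v = u \<longleftrightarrow> v ! (i - 1) = ?k \<and> v ! i = ?l \<and> rest"
    unfolding two[symmetric] using len by (simp only: list_eq_iff_nth_eq simp_thms)
  show ?thesis unfolding swap stay pi_word_coeff_def rest_def[symmetric]
    by (cases ?k ?l rule: linorder_cases)
      (simp_all add: pi_coeff_def swap_coeff_def stay_coeff_def parity_def of_bool_def)
qed

lemma set_tensor_basis: "set (tensor_basis d n) = {u. length u = n \<and> set u \<subseteq> {1..d}}"
  by (auto simp: tensor_basis_def set_n_lists)

lemma distinct_tensor_basis: "distinct (tensor_basis d n)"
  by (simp add: tensor_basis_def distinct_n_lists)

lemma length_tensor_basis: "length (tensor_basis d n) = d ^ n"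
  by (simp add: tensor_basis_def length_n_lists del: upt_Suc)

lemma swap_at_tensor_basis:
  assumes "u \<in> set (tensor_basis d n)" "i \<in> {1..<n}"
  shows "swap_at i u \<in> set (tensor_basis d n)"
proof -
  have "set (swap_at i u) \<subseteq> set u"
    using assms by (auto simp: set_tensor_basis swap_at_def in_set_conv_nth nth_list_update)
  then show ?thesis using assms by (auto simp: set_tensor_basis)
qed

lemma sum_pi_word_coeff:
  assumes u: "u \<in> set (tensor_basis d n)" and i: "i \<in> {1..<n}"
  shows "(\<Sum>v\<in>set (tensor_basis d n). pi_word_coeff a i u v * f v) = pi_op a i f u"
proof -
  let ?W = "set (tensor_basis d n)"
  have "(\<Sum>v\<in>?W. pi_word_coeff a i u v * f v)
    = (\<Sum>v\<in>?W. (if v = swap_at i u then swap_coeff a (u ! (i - 1)) (u ! i) * f v else 0)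
       + (if v = u then stay_coeff a (u ! (i - 1)) (u ! i) * f v else 0))"
  proof (rule sum.cong[OF refl])
    fix v assume "v \<in> ?W"
    then have "pi_word_coeff a i u v = swap_coeff a (u ! (i - 1)) (u ! i) * of_bool (v = swap_at i u)
      + stay_coeff a (u ! (i - 1)) (u ! i) * of_bool (v = u)"
      using u i by (intro pi_word_coeff_eq) (auto simp: set_tensor_basis)
    then show "pi_word_coeff a i u v * f v
      = (if v = swap_at i u then swap_coeff a (u ! (i - 1)) (u ! i) * f v else 0)
       + (if v = u then stay_coeff a (u ! (i - 1)) (u ! i) * f v else 0)"
      by (simp add: distrib_right)
  qed
  also have "\<dots> = pi_op a i f u"
    using u swap_at_tensor_basis[OF u i] by (simp add: sum.distrib pi_op_def)
  finally show ?thesis .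
qed

lemma pi_op_quadratic:
  assumes "1 \<le> i" "i < length u"
  shows "pi_op a i (pi_op a i f) u = (qq - 1) * pi_op a i f u + qq * f u"
proof -
  have "swap_at i (swap_at i u) = u"
    using assms by (intro nth_equalityI) (simp_all add: nth_swap_at)
  moreover have "swap_at i u ! (i - 1) = u ! i" "swap_at i u ! i = u ! (i - 1)"
    using assms by (simp_all add: nth_swap_at)
  ultimately show ?thesis
    by (cases "u ! (i - 1)" "u ! i" rule: linorder_cases)
      (simp_all add: pi_op_def swap_coeff_def stay_coeff_def algebra_simps)
qed

lemma pi_op_commute:
  assumes "1 \<le> i" "i + 1 < j" "j < length u"
  shows "pi_op a i (pi_op a j f) u = pi_op a j (pi_op a i f) u"
proof -
  have "swap_at i (swap_at j u) = swap_at j (swap_at i u)"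
    using assms by (intro nth_equalityI) (auto simp: nth_swap_at)
  moreover have "swap_at i u ! (j - 1) = u ! (j - 1)" "swap_at i u ! j = u ! j"
    "swap_at j u ! (i - 1) = u ! (i - 1)" "swap_at j u ! i = u ! i"
    using assms by (auto simp: nth_swap_at)
  ultimately show ?thesis
    by (simp add: pi_op_def algebra_simps)
qed

lemma stay_coeff_less: "k < l \<Longrightarrow> stay_coeff a k l = qq - 1"
  and stay_coeff_greater: "l < k \<Longrightarrow> stay_coeff a k l = 0"
  by (simp_all add: stay_coeff_def)

lemma stay_coeff_square: "stay_coeff a k k * stay_coeff a k k = (qq - 1) * stay_coeff a k k + qq"
  by (simp add: stay_coeff_def algebra_simps)

lemma swap_coeff_same: "swap_coeff a k k = 0"
  by (simp add: swap_coeff_def)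

lemma swap_coeff_mult: "k \<noteq> l \<Longrightarrow> swap_coeff a k l * swap_coeff a l k = qq"
  by (auto simp: swap_coeff_def)

text \<open>Expanding both sides of the braid relation on three adjacent letters \<open>x y z\<close> gives a combination of
  their six rearrangements. The coefficients of three of them agree term by term; the next three
  identities are about the coefficients of \<open>x y z\<close>, \<open>y x z\<close> and \<open>x z y\<close>.\<close>

lemma braid_coeff_stay:
  "stay_coeff a x z * (swap_coeff a x y * swap_coeff a y x) + (stay_coeff a x y * stay_coeff a x y) * stay_coeff a y z
   = stay_coeff a x z * (swap_coeff a y z * swap_coeff a z y) + (stay_coeff a y z * stay_coeff a y z) * stay_coeff a x y"
proof (cases x y rule: linorder_cases)
  case less
  then show ?thesis
    by (cases y z rule: linorder_cases)
      (simp_all add: stay_coeff_less stay_coeff_greater swap_coeff_same swap_coeff_mult stay_coeff_square algebra_simps)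
next
  case equal
  then show ?thesis
    by (cases y z rule: linorder_cases)
      (simp_all add: stay_coeff_less stay_coeff_greater swap_coeff_same swap_coeff_mult stay_coeff_square algebra_simps)
next
  case greater
  then show ?thesis
    by (cases y z rule: linorder_cases)
      (simp_all add: stay_coeff_less stay_coeff_greater swap_coeff_same swap_coeff_mult stay_coeff_square algebra_simps)
qed

lemma braid_coeff_left:
  "swap_coeff a x y * (stay_coeff a x z * stay_coeff a y x + stay_coeff a x y * stay_coeff a y z)
   = swap_coeff a x y * (stay_coeff a y z * stay_coeff a x z)"
  by (cases x y rule: linorder_cases; cases y z rule: linorder_cases; cases x z rule: linorder_cases;
      simp add: stay_coeff_less stay_coeff_greater swap_coeff_same)

lemma braid_coeff_right:
  "swap_coeff a y z * (stay_coeff a x y * stay_coeff a x z)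
   = swap_coeff a y z * (stay_coeff a x z * stay_coeff a z y + stay_coeff a y z * stay_coeff a x y)"
  by (cases x y rule: linorder_cases; cases y z rule: linorder_cases; cases x z rule: linorder_cases;
      simp add: stay_coeff_less stay_coeff_greater swap_coeff_same)

lemma pi_op_braid:
  assumes "1 \<le> i" "i + 1 < length u"
  shows "pi_op a i (pi_op a (i + 1) (pi_op a i f)) u = pi_op a (i + 1) (pi_op a i (pi_op a (i + 1) f)) u"
proof -
  define U where "U x y z = u[i - 1 := x, i := y, i + 1 := z]" for x y z
  have left: "pi_op a i f (U x y z) = swap_coeff a x y * f (U y x z) + stay_coeff a x y * f (U x y z)" for f x y z
  proof -
    have "U x y z ! (i - 1) = x" "U x y z ! i = y" 
      using assms by (simp_all add: U_def)
    moreover have "swap_at i (U x y z) = U y x z"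
      using assms by (intro nth_equalityI) (auto simp: U_def nth_swap_at nth_list_update)
    ultimately show ?thesis by (simp add: pi_op_def)
  qed
  have right: "pi_op a (i + 1) f (U x y z) = swap_coeff a y z * f (U x z y) + stay_coeff a y z * f (U x y z)" for f x y z
  proof -
    have "U x y z ! (i + 1 - 1) = y" "U x y z ! (i + 1) = z"
      using assms by (simp_all add: U_def)
    moreover have "swap_at (i + 1) (U x y z) = U x z y"
      using assms by (intro nth_equalityI) (auto simp: U_def nth_swap_at nth_list_update)
    ultimately show ?thesis unfolding pi_op_def by simp
  qed
  have "u = U (u ! (i - 1)) (u ! i) (u ! (i + 1))"
    by (simp add: U_def)
  moreover have "pi_op a i (pi_op a (i + 1) (pi_op a i f)) (U x y z)
      = pi_op a (i + 1) (pi_op a i (pi_op a (i + 1) f)) (U x y z)" for x y z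
  proof -
    let ?S = "swap_coeff a" and ?D = "stay_coeff a"
    have "pi_op a i (pi_op a (i + 1) (pi_op a i f)) (U x y z)
      = ?S x y * ?S x z * ?S y z * f (U z y x) + ?S x y * ?S x z * ?D y z * f (U y z x)
      + ?D x y * ?S x z * ?S y z * f (U z x y)
      + (?D x z * (?S x y * ?S y x) + (?D x y * ?D x y) * ?D y z) * f (U x y z)
      + ?S x y * (?D x z * ?D y x + ?D x y * ?D y z) * f (U y x z)
      + ?S y z * (?D x y * ?D x z) * f (U x z y)"
      unfolding left right by (simp add: algebra_simps)
    also have "\<dots> = ?S x y * ?S x z * ?S y z * f (U z y x) + ?S x y * ?S x z * ?D y z * f (U y z x)
      + ?D x y * ?S x z * ?S y z * f (U z x y)
      + (?D x z * (?S y z * ?S z y) + (?D y z * ?D y z) * ?D x y) * f (U x y z)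
      + ?S x y * (?D y z * ?D x z) * f (U y x z)
      + ?S y z * (?D x z * ?D z y + ?D y z * ?D x y) * f (U x z y)"
      by (simp only: braid_coeff_stay[where x = x and y = y and z = z]
          braid_coeff_left[where x = x and y = y and z = z] braid_coeff_right[where x = x and y = y and z = z])
    also have "\<dots> = pi_op a (i + 1) (pi_op a i (pi_op a (i + 1) f)) (U x y z)"
      unfolding left right by (simp add: algebra_simps)
    finally show ?thesis .
  qed
  ultimately show ?thesis by metis
qed


section \<open>The sign q-permutation representation satisfies the relations\<close>

definition kernel_mat :: "nat list list \<Rightarrow> (nat list \<Rightarrow> nat list \<Rightarrow> qfield) \<Rightarrow> qfield mat" where
  "kernel_mat B K = mat (length B) (length B) (\<lambda>(r, s). K (B ! r) (B ! s))"

lemma kernel_mat_carrier: "kernel_mat B K \<in> carrier_mat (length B) (length B)"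
  by (simp add: kernel_mat_def)

lemma kernel_mat_cong:
  assumes "\<And>u v. u \<in> set B \<Longrightarrow> v \<in> set B \<Longrightarrow> K u v = L u v"
  shows "kernel_mat B K = kernel_mat B L"
  using assms by (intro eq_matI) (auto simp: kernel_mat_def)

lemma sum_nth_distinct:
  assumes "distinct B"
  shows "(\<Sum>k = 0..<length B. F (B ! k)) = (\<Sum>v\<in>set B. F v)"
  using sum.reindex_bij_betw[OF bij_betw_nth[OF assms refl refl], of F] by (simp add: atLeast0LessThan)

lemma kernel_mat_mult:
  assumes "distinct B"
  shows "kernel_mat B K * kernel_mat B L = kernel_mat B (\<lambda>u v. \<Sum>w\<in>set B. K u w * L w v)"
  by (rule eq_matI) (simp_all add: kernel_mat_def scalar_prod_def sum_nth_distinct[OF assms, of "\<lambda>w. K _ w * L w _"])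

lemma kernel_mat_one: "distinct B \<Longrightarrow> 1\<^sub>m (length B) = kernel_mat B (\<lambda>u v. of_bool (u = v))"
  by (rule eq_matI) (auto simp: kernel_mat_def nth_eq_iff_index_eq)

lemma kernel_mat_add: "kernel_mat B K + kernel_mat B L = kernel_mat B (\<lambda>u v. K u v + L u v)"
  by (rule eq_matI) (auto simp: kernel_mat_def)

lemma kernel_mat_smult: "c \<cdot>\<^sub>m kernel_mat B K = kernel_mat B (\<lambda>u v. c * K u v)"
  by (rule eq_matI) (auto simp: kernel_mat_def)

lemma mat_trace_kernel_mat:
  assumes "distinct B"
  shows "mat_trace (kernel_mat B K) = (\<Sum>u\<in>set B. K u u)"
proof -
  have "mat_trace (kernel_mat B K) = (\<Sum>r = 0..<length B. K (B ! r) (B ! r))"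
    unfolding mat_trace_def diag_mat_def
    by (simp add: kernel_mat_def interv_sum_list_conv_sum_set_nat)
  then show ?thesis using sum_nth_distinct[OF assms] by simp
qed

lemma pi_mat_kernel: "pi_mat a b n i = kernel_mat (tensor_basis (a + b) n) (pi_word_coeff a i)"
  by (simp add: pi_mat_def kernel_mat_def Let_def)

lemma pi_mat_carrier: "pi_mat a b n i \<in> carrier_mat ((a + b) ^ n) ((a + b) ^ n)"
  using kernel_mat_carrier[of "tensor_basis (a + b) n"] by (simp add: pi_mat_kernel length_tensor_basis)

lemma pi_mat_mult_kernel:
  assumes "i \<in> {1..<n}"
  shows "pi_mat a b n i * kernel_mat (tensor_basis (a + b) n) K
     = kernel_mat (tensor_basis (a + b) n) (\<lambda>u v. pi_op a i (\<lambda>w. K w v) u)"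
  unfolding pi_mat_kernel kernel_mat_mult[OF distinct_tensor_basis]
  by (rule kernel_mat_cong) (rule sum_pi_word_coeff[OF _ assms])

lemma pi_mat_as_op:
  assumes "i \<in> {1..<n}"
  shows "pi_mat a b n i = kernel_mat (tensor_basis (a + b) n) (\<lambda>u v. pi_op a i (\<lambda>w. of_bool (w = v)) u)"
  using pi_mat_mult_kernel[OF assms, of a b "\<lambda>u v. of_bool (u = v)"]
    right_mult_one_mat[OF pi_mat_carrier[of a b n i]]
  by (simp add: kernel_mat_one[OF distinct_tensor_basis, symmetric] length_tensor_basis)

lemma hecke_rep_sign_perm_rep:
  "hecke_rep n ((a + b) ^ n) (sign_perm_rep a b n)"
  "i \<in> {1..<n} \<Longrightarrow> sign_perm_rep a b n (hecke_gen n i) = pi_mat a b n i"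
proof -
  let ?B = "tensor_basis (a + b) n"
  have one: "1\<^sub>m ((a + b) ^ n) = kernel_mat ?B (\<lambda>u v. of_bool (u = v))"
    using kernel_mat_one[OF distinct_tensor_basis] by (simp add: length_tensor_basis)
  have two: "pi_mat a b n i * pi_mat a b n j
      = kernel_mat ?B (\<lambda>u v. pi_op a i (pi_op a j (\<lambda>w. of_bool (w = v))) u)"
    if "i \<in> {1..<n}" "j \<in> {1..<n}" for i j
    unfolding pi_mat_as_op[OF that(2)] by (rule pi_mat_mult_kernel[OF that(1)])
  have three: "pi_mat a b n i * pi_mat a b n j * pi_mat a b n k
      = kernel_mat ?B (\<lambda>u v. pi_op a i (pi_op a j (pi_op a k (\<lambda>w. of_bool (w = v)))) u)"
    if "i \<in> {1..<n}" "j \<in> {1..<n}" "k \<in> {1..<n}" for i j k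
    unfolding assoc_mult_mat[OF pi_mat_carrier pi_mat_carrier pi_mat_carrier] two[OF that(2,3)]
    by (rule pi_mat_mult_kernel[OF that(1)])
  have len: "length u = n" if "u \<in> set ?B" for u using that by (simp add: set_tensor_basis)
  have "\<exists>\<rho>. hecke_rep n ((a + b) ^ n) \<rho> \<and> (\<forall>i\<in>{1..<n}. \<rho> (hecke_gen n i) = pi_mat a b n i)"
  proof (rule hecke_rep_from_matrices)
    fix i j assume ij: "i \<in> {1..<n}" "j \<in> {1..<n}" "i + 1 < j"
    show "pi_mat a b n i * pi_mat a b n j = pi_mat a b n j * pi_mat a b n i"
      unfolding two[OF ij(1,2)] two[OF ij(2,1)]
      by (rule kernel_mat_cong, rule pi_op_commute) (use ij len in auto)
  next
    fix i assume i: "i \<in> {1..<n}" "i + 1 \<in> {1..<n}"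
    show "pi_mat a b n i * pi_mat a b n (i + 1) * pi_mat a b n i
        = pi_mat a b n (i + 1) * pi_mat a b n i * pi_mat a b n (i + 1)"
      unfolding three[OF i(1,2,1)] three[OF i(2,1,2)]
      by (rule kernel_mat_cong, rule pi_op_braid) (use i len in auto)
  next
    fix i assume i: "i \<in> {1..<n}"
    show "pi_mat a b n i * pi_mat a b n i = (qq - 1) \<cdot>\<^sub>m pi_mat a b n i + qq \<cdot>\<^sub>m 1\<^sub>m ((a + b) ^ n)"
      unfolding two[OF i i] one unfolding pi_mat_as_op[OF i] kernel_mat_smult kernel_mat_add
      by (rule kernel_mat_cong, rule pi_op_quadratic) (use i len in auto)
  qed (rule pi_mat_carrier)
  from someI_ex[OF this, folded sign_perm_rep_def]
  show "hecke_rep n ((a + b) ^ n) (sign_perm_rep a b n)"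
    "i \<in> {1..<n} \<Longrightarrow> sign_perm_rep a b n (hecke_gen n i) = pi_mat a b n i"
    by auto
qed

section \<open>Characters on products of distinct generators\<close>

lemma word_mat_pi_mat:
  assumes "set w \<subseteq> {1..<n}"
  shows "word_mat ((a + b) ^ n) (pi_mat a b n) w
    = kernel_mat (tensor_basis (a + b) n) (\<lambda>u v. foldr (pi_op a) w (\<lambda>w. of_bool (w = v)) u)"
  using assms
proof (induction w)
  case Nil
  then show ?case
    using kernel_mat_one[OF distinct_tensor_basis, of "a + b" n] by (simp add: word_mat_def length_tensor_basis)
next
  case (Cons i w)
  then have i: "i \<in> {1..<n}"
    and IH: "word_mat ((a + b) ^ n) (pi_mat a b n) w
      = kernel_mat (tensor_basis (a + b) n) (\<lambda>u v. foldr (pi_op a) w (\<lambda>w. of_bool (w = v)) u)"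
    by simp_all
  have "word_mat ((a + b) ^ n) (pi_mat a b n) (i # w) = pi_mat a b n i * word_mat ((a + b) ^ n) (pi_mat a b n) w"
    by (simp add: word_mat_def)
  then show ?case unfolding IH pi_mat_mult_kernel[OF i] by simp
qed

lemma mset_take_swap_at:
  assumes "1 \<le> i" "i < length u" "j \<noteq> i"
  shows "mset (take j (swap_at i u)) = mset (take j u)"
proof (cases "i < j")
  case True
  have "take j (swap_at i u) = (take j u)[i - 1 := take j u ! i, i := take j u ! (i - 1)]"
    using True by (simp add: swap_at_def take_update_swap)
  then show ?thesis
    using mset_swap[of i "take j u" "i - 1"] True assms by (simp add: less_imp_diff_less)
next
  case False
  then show ?thesis using assms by (simp add: swap_at_def)
qed

text \<open>Only the operator with index \<open>j\<close> moves letters between the first \<open>j\<close> positions and the others.\<close>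

lemma foldr_pi_op_content:
  assumes "set w \<subseteq> {1..<length u}" "j \<notin> set w" "foldr (pi_op a) w (\<lambda>w. of_bool (w = v)) u \<noteq> 0"
  shows "mset (take j u) = mset (take j v)"
  using assms
proof (induction w arbitrary: u)
  case (Cons i w)
  let ?f = "foldr (pi_op a) w (\<lambda>w. of_bool (w = v))"
  have "?f (swap_at i u) \<noteq> 0 \<or> ?f u \<noteq> 0"
    using Cons.prems(3) pi_op_def[of a i ?f u] by auto
  then show ?case
  proof
    assume "?f (swap_at i u) \<noteq> 0"
    then have "mset (take j (swap_at i u)) = mset (take j v)"
      using Cons.IH[of "swap_at i u"] Cons.prems by simp
    then show ?thesis using mset_take_swap_at[of i u j] Cons.prems by auto
  next
    assume "?f u \<noteq> 0"
    then show ?thesis using Cons.IH[of u] Cons.prems by simp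
  qed
qed simp

text \<open>A path from \<open>u\<close> back to \<open>u\<close> cannot start by exchanging two different letters at the positions
  \<open>i - 1\<close> and \<open>i\<close>: this changes the multiset of the first \<open>i\<close> letters, and none of the
  remaining operators can change it back. So only the path that never moves contributes.\<close>
lemma foldr_pi_op_diagonal:
  assumes "distinct w" "set w \<subseteq> {1..<length u}"
  shows "foldr (pi_op a) w (\<lambda>w. of_bool (w = u)) u = (\<Prod>i\<in>set w. stay_coeff a (u ! (i - 1)) (u ! i))"
  using assms
proof (induction w)
  case (Cons i w)
  let ?f = "foldr (pi_op a) w (\<lambda>w. of_bool (w = u))"
  have i: "1 \<le> i" "i < length u" "i \<notin> set w" using Cons.prems by auto
  have "swap_coeff a (u ! (i - 1)) (u ! i) * ?f (swap_at i u) = 0"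
  proof (cases "u ! (i - 1) = u ! i")
    case False
    have "?f (swap_at i u) = 0"
    proof (rule ccontr)
      assume "?f (swap_at i u) \<noteq> 0"
      then have "mset (take i (swap_at i u)) = mset (take i u)"
        using foldr_pi_op_content[of w "swap_at i u" i] Cons.prems i by simp
      moreover have take: "take i v = take (i - 1) v @ [v ! (i - 1)]" if "length v = length u" for v :: "nat list"
        using take_Suc_conv_app_nth[of "i - 1" v] i that by simp
      moreover have "take (i - 1) (swap_at i u) = take (i - 1) u"
        by (simp add: swap_at_def)
      moreover have "swap_at i u ! (i - 1) = u ! i"
        using i by (simp add: nth_swap_at)
      ultimately have "mset (take (i - 1) u @ [u ! i]) = mset (take (i - 1) u @ [u ! (i - 1)])"
        using take[of u] take[of "swap_at i u"] by (simp only: length_swap_at)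
      then show False using False by simp
    qed
    then show ?thesis by simp
  qed (simp add: swap_coeff_def)
  then have "pi_op a i ?f u = stay_coeff a (u ! (i - 1)) (u ! i) * ?f u"
    unfolding pi_op_def[of a i ?f u] by simp
  then show ?case using Cons i by simp
qed simp

lemma hecke_T_reduced_expr:
  assumes "reduced_expr n p w0"
  shows "\<exists>w. reduced_expr n p w \<and> hecke_T n p = foldr (\<lambda>i x. hecke_gen n i \<otimes>\<^bsub>hecke n\<^esub> x) w \<one>\<^bsub>hecke n\<^esub>"
  using someI[of "reduced_expr n p", OF assms] unfolding hecke_T_def by blast

lemma ring_hecke: "ring (hecke n)"
  unfolding hecke_def by (rule ideal.quotient_is_ring[OF hecke_ideal])

lemma hecke_rep_word:
  assumes \<rho>: "hecke_rep n d \<rho>" and gen: "\<And>i. i \<in> {1..<n} \<Longrightarrow> \<rho> (hecke_gen n i) = A i"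
    and w: "set w \<subseteq> {1..<n}"
  shows "foldr (\<lambda>i x. hecke_gen n i \<otimes>\<^bsub>hecke n\<^esub> x) w \<one>\<^bsub>hecke n\<^esub> \<in> carrier (hecke n)"
    and "\<rho> (foldr (\<lambda>i x. hecke_gen n i \<otimes>\<^bsub>hecke n\<^esub> x) w \<one>\<^bsub>hecke n\<^esub>) = word_mat d A w"
proof -
  interpret H: ring "hecke n" by (rule ring_hecke)
  have hom: "\<rho> \<in> Ring.ring_hom (hecke n) (ring_mat TYPE(qfield) d ())"
    using \<rho> by (simp add: hecke_rep_def)
  let ?T = "\<lambda>w. foldr (\<lambda>i x. hecke_gen n i \<otimes>\<^bsub>hecke n\<^esub> x) w \<one>\<^bsub>hecke n\<^esub>"
  have "?T w \<in> carrier (hecke n) \<and> \<rho> (?T w) = word_mat d A w"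
    using w
  proof (induction w)
    case Nil
    then show ?case using ring_hom_one[OF hom] by (simp add: word_mat_def ring_mat_simps)
  next
    case (Cons i w)
    then have i: "i \<in> {1..<n}" and IH: "?T w \<in> carrier (hecke n)" "\<rho> (?T w) = word_mat d A w" by simp_all
    show ?case
      using ring_hom_mult[OF hom hecke_gen_carrier[OF i] IH(1)] H.m_closed[OF hecke_gen_carrier[OF i] IH(1)] gen[OF i] IH(2)
      by (simp add: word_mat_def ring_mat_simps)
  qed
  then show "?T w \<in> carrier (hecke n)" "\<rho> (?T w) = word_mat d A w" by simp_all
qed

lemma sign_perm_char_distinct:
  assumes red: "reduced_expr n p w0"
    and letters: "\<And>w. reduced_expr n p w \<Longrightarrow> distinct w \<and> set w = J"
  shows "sign_perm_char a b n (hecke_T n p)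
    = (\<Sum>u\<in>{u. length u = n \<and> set u \<subseteq> {1..a + b}}. \<Prod>i\<in>J. stay_coeff a (u ! (i - 1)) (u ! i))"
proof -
  obtain w where w: "reduced_expr n p w"
    and T: "hecke_T n p = foldr (\<lambda>i x. hecke_gen n i \<otimes>\<^bsub>hecke n\<^esub> x) w \<one>\<^bsub>hecke n\<^esub>"
    using hecke_T_reduced_expr[OF red] by blast
  have w': "set w \<subseteq> {1..<n}" "distinct w" "set w = J"
    using w letters[OF w] by (auto simp: reduced_expr_def)
  let ?B = "tensor_basis (a + b) n"
  have "sign_perm_char a b n (hecke_T n p) = mat_trace (word_mat ((a + b) ^ n) (pi_mat a b n) w)"
    unfolding sign_perm_char_def hecke_character_def T
    using hecke_rep_word[where A = "pi_mat a b n", OF hecke_rep_sign_perm_rep(1) hecke_rep_sign_perm_rep(2) w'(1)]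
    by simp
  also have "\<dots> = (\<Sum>u\<in>set ?B. foldr (pi_op a) w (\<lambda>w. of_bool (w = u)) u)"
    unfolding word_mat_pi_mat[OF w'(1)] by (rule mat_trace_kernel_mat[OF distinct_tensor_basis])
  also have "\<dots> = (\<Sum>u\<in>set ?B. \<Prod>i\<in>J. stay_coeff a (u ! (i - 1)) (u ! i))"
    using w' by (intro sum.cong refl) (simp add: foldr_pi_op_diagonal set_tensor_basis)
  finally show ?thesis by (simp add: set_tensor_basis)
qed

section \<open>Reduced expressions of products of cycles\<close>

text \<open>The word that results from writing each cycle as \<open>(1 2 \<dots> r) = s\<^sub>1 s\<^sub>2 \<dots> s\<^sub>r\<^sub>-\<^sub>1\<close>.\<close>

fun sigma_word :: "nat \<Rightarrow> nat list \<Rightarrow> nat list" where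
  "sigma_word b [] = []"
| "sigma_word b (m # ms) = [b + 1..<b + m] @ sigma_word (b + m) ms"

lemma perm_of_word_append: "perm_of_word (v @ w) = perm_of_word v \<circ> perm_of_word w"
  by (induction v) (simp_all add: perm_of_word_def comp_assoc)

lemma perm_of_word_Cons: "perm_of_word (i # w) = transpose i (i + 1) \<circ> perm_of_word w"
  by (simp add: perm_of_word_def)

lemma cycle_of_list_upt:
  "cycle_of_list [b + 1..<b + m + 1] = perm_of_word [b + 1..<b + m]"
proof (induction m arbitrary: b)
  case (Suc m)
  show ?case
  proof (cases m)
    case (Suc k)
    define xs where "xs = [Suc b + 2..<Suc b + m + 1]"
    have e1: "[Suc b + 1..<Suc b + m + 1] = (Suc b + 1) # xs"
      using Suc upt_conv_Cons[of "Suc b + 1" "Suc b + m + 1"] by (simp add: xs_def del: upt_Suc)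
    have e2: "[b + 1..<b + Suc m + 1] = (b + 1) # [Suc b + 1..<Suc b + m + 1]"
      using upt_conv_Cons[of "b + 1" "b + Suc m + 1"] by (simp del: upt_Suc)
    have e3: "[b + 1..<b + Suc m] = (b + 1) # [Suc b + 1..<Suc b + m]"
      using Suc upt_conv_Cons[of "b + 1" "b + Suc m"] by (simp del: upt_Suc)
    have "cycle_of_list [b + 1..<b + Suc m + 1] = transpose (b + 1) (Suc b + 1) \<circ> cycle_of_list ((Suc b + 1) # xs)"
      unfolding e2 e1 cycle_of_list.simps(1) ..
    also have "\<dots> = perm_of_word [b + 1..<b + Suc m]"
      unfolding e1[symmetric] Suc.IH[of "Suc b"] e3 perm_of_word_Cons by simp
    finally show ?thesis .
  qed (simp add: perm_of_word_def)
qed (simp add: perm_of_word_def)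

lemma perm_of_sigma_word: "perm_of_word (sigma_word b \<mu>) = sigma_from b \<mu>"
proof (induction b \<mu> rule: sigma_word.induct)
  case (2 b m ms)
  then show ?case
    by (simp only: sigma_word.simps sigma_from.simps perm_of_word_append cycle_of_list_upt)
qed (simp add: perm_of_word_def)

lemma sigma_word_props:
  "distinct (sigma_word b \<mu>)" "set (sigma_word b \<mu>) \<subseteq> {b + 1..<b + sum_list \<mu>}"
proof (induction b \<mu> rule: sigma_word.induct)
  case (2 b m ms)
  { case 1 show ?case using 2 by fastforce }
  { case 2 show ?case using \<open>set (sigma_word (b + m) ms) \<subseteq> _\<close> by fastforce }
qed simp_all

lemma bij_perm_of_word: "bij (perm_of_word w)"
proof (induction w)
  case Nil
  have "perm_of_word [] = id" by (simp add: perm_of_word_def)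
  then show ?case by (simp only: bij_id)
next
  case (Cons i w)
  then show ?case unfolding perm_of_word_Cons by (rule bij_comp) simp
qed

lemma perm_of_word_le_iff:
  "j \<notin> set w \<Longrightarrow> perm_of_word w x \<le> j \<longleftrightarrow> x \<le> j"
proof (induction w)
  case (Cons i w)
  have "transpose i (i + 1) y \<le> j \<longleftrightarrow> y \<le> j" for y
    using Cons.prems by (auto simp: transpose_def)
  then show ?case using Cons by (simp add: perm_of_word_Cons)
qed (simp add: perm_of_word_def)

text \<open>A word without the letter \<open>j\<close> preserves the set of numbers up to \<open>j\<close>, whereas a word in which
  \<open>j\<close> occurs exactly once sends some number from this set out of it.\<close>

lemma letter_in_word:
  assumes "perm_of_word w = perm_of_word w'" "distinct w" "j \<in> set w"
  shows "j \<in> set w'"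
proof (rule ccontr)
  assume j: "j \<notin> set w'"
  obtain v1 v2 where w: "w = v1 @ j # v2" using assms(3) split_list by metis
  then have "j \<notin> set v1" "j \<notin> set v2" using assms(2) by auto
  \<comment> \<open>The part \<open>v2\<close> of the word acts first, so that \<open>x\<close> reaches \<open>j\<close> just before \<open>s\<^sub>j\<close> is applied.\<close>
  obtain x where x: "perm_of_word v2 x = j"
    using bij_perm_of_word[of v2] by (metis bij_pointE)
  then have "x \<le> j" using perm_of_word_le_iff[OF \<open>j \<notin> set v2\<close>, of x] by simp
  moreover have "perm_of_word w x = perm_of_word v1 (j + 1)"
    by (simp add: w perm_of_word_append perm_of_word_Cons x)
  then have "\<not> perm_of_word w x \<le> j" using perm_of_word_le_iff[OF \<open>j \<notin> set v1\<close>] by simp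
  ultimately show False using perm_of_word_le_iff[OF j] assms(1) by metis
qed

text \<open>Every word for the same permutation contains each of the letters of \<open>w0\<close>, and a reduced one is
  not longer than \<open>w0\<close>, so that no letter is left to be repeated or added. This takes the place of
  Matsumoto's theorem: a trace that depends only on the set of letters is the same for all reduced
  expressions.\<close>

lemma reduced_expr_of_distinct:
  assumes "distinct w0" "set w0 \<subseteq> {1..<n}"
  shows "reduced_expr n (perm_of_word w0) w0"
    and "reduced_expr n (perm_of_word w0) w \<Longrightarrow> distinct w \<and> set w = set w0"
proof -
  have sub: "set w0 \<subseteq> set w" if "perm_of_word w = perm_of_word w0" for w
    using letter_in_word[of w0 w] assms(1) that by auto
  have le: "length w0 \<le> length w" if "perm_of_word w = perm_of_word w0" for w
    using card_mono[OF _ sub[OF that]] card_length[of w] distinct_card[OF assms(1)] by simp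
  show "reduced_expr n (perm_of_word w0) w0"
    using le assms(2) by (simp add: reduced_expr_def)
  assume red: "reduced_expr n (perm_of_word w0) w"
  then have w: "perm_of_word w = perm_of_word w0" "length w \<le> length w0"
    using assms(2) by (auto simp: reduced_expr_def)
  then have "card (set w) \<le> card (set w0)" using card_length[of w] distinct_card[OF assms(1)] by simp
  then have eq: "set w = set w0" using card_seteq[OF _ sub[OF w(1)]] by simp
  have "length w = card (set w)" using w(2) le[OF w(1)] distinct_card[OF assms(1)] eq by simp
  then show "distinct w \<and> set w = set w0" using eq card_distinct[of w] by simp
qed

section \<open>Sums over words factor over the blocks\<close>

lemma sigma_word_shift: "set (sigma_word (b + c) \<mu>) = (+) c ` set (sigma_word b \<mu>)"
proof (induction b \<mu> rule: sigma_word.induct)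
  case (2 b m ms)
  have "b + m + c = (b + c) + m" by simp
  with 2 have "set (sigma_word (b + c + m) ms) = (+) c ` set (sigma_word (b + m) ms)" by metis
  then show ?case by (simp add: image_Un add.commute add.left_commute)
qed simp

lemma sum_words_append:
  fixes F :: "nat list \<Rightarrow> qfield"
  shows "(\<Sum>u\<in>{u. length u = m + k \<and> set u \<subseteq> A}. F u)
    = (\<Sum>u\<in>{u. length u = m \<and> set u \<subseteq> A}. \<Sum>v\<in>{v. length v = k \<and> set v \<subseteq> A}. F (u @ v))"
proof -
  have "(\<Sum>u\<in>{u. length u = m + k \<and> set u \<subseteq> A}. F u)
     = (\<Sum>(u, v)\<in>{u. length u = m \<and> set u \<subseteq> A} \<times> {v. length v = k \<and> set v \<subseteq> A}. F (u @ v))"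
    by (rule sum.reindex_bij_witness[where i = "\<lambda>(u, v). u @ v" and j = "\<lambda>u. (take m u, drop m u)"])
      (auto dest: in_set_takeD in_set_dropD)
  then show ?thesis by (simp add: sum.cartesian_product)
qed

text \<open>The sum of all entries of the \<open>(m - 1)\<close>-st power of the matrix \<open>\<phi>\<close> with index set \<open>A\<close>, for
  positive \<open>m\<close>.\<close>

definition block_sum :: "(nat \<Rightarrow> nat \<Rightarrow> qfield) \<Rightarrow> nat set \<Rightarrow> nat \<Rightarrow> qfield" where
  "block_sum \<phi> A m = (\<Sum>u\<in>{u. length u = m \<and> set u \<subseteq> A}. \<Prod>i\<in>{1..<m}. \<phi> (u ! (i - 1)) (u ! i))"

lemma sum_words_blocks:
  "(\<Sum>u\<in>{u. length u = sum_list \<mu> \<and> set u \<subseteq> A}. \<Prod>i\<in>set (sigma_word 0 \<mu>). \<phi> (u ! (i - 1)) (u ! i))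
    = (\<Prod>m\<leftarrow>\<mu>. block_sum \<phi> A m)"
proof (induction \<mu>)
  case Nil
  have "{u :: nat list. length u = 0 \<and> set u \<subseteq> A} = {[]}" by auto
  then show ?case by simp
next
  case (Cons m \<mu>)
  let ?W = "\<lambda>k. {u. length u = k \<and> set u \<subseteq> A}"
  let ?J = "set (sigma_word 0 \<mu>)"
  let ?P = "\<lambda>J u. \<Prod>i\<in>J. \<phi> (u ! (i - 1)) (u ! i)"
  have J: "set (sigma_word 0 (m # \<mu>)) = {1..<m} \<union> (+) m ` ?J"
    using sigma_word_shift[of 0 m \<mu>] by auto
  have pos: "1 \<le> i" if "i \<in> ?J" for i using that sigma_word_props(2)[of 0 \<mu>] by auto
  have factor: "?P (set (sigma_word 0 (m # \<mu>))) (u @ v) = ?P {1..<m} u * ?P ?J v" if u: "length u = m" for u v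
  proof -
    have "?P (set (sigma_word 0 (m # \<mu>))) (u @ v) = ?P {1..<m} (u @ v) * ?P ((+) m ` ?J) (u @ v)"
      unfolding J by (rule prod.union_disjoint) (auto dest: pos)
    moreover have "?P {1..<m} (u @ v) = ?P {1..<m} u"
      using u by (intro prod.cong) (auto simp: nth_append)
    moreover have "?P ((+) m ` ?J) (u @ v) = ?P ?J v"
    proof -
      have "\<phi> ((u @ v) ! (m + x - 1)) ((u @ v) ! (m + x)) = \<phi> (v ! (x - 1)) (v ! x)" if "x \<in> ?J" for x
        using nth_append_length_plus[of u v x] nth_append_length_plus[of u v "x - 1"] u pos[OF that] by simp
      then show ?thesis by (simp add: prod.reindex)
    qed
    ultimately show ?thesis by simp
  qed
  have "(\<Sum>u\<in>?W (sum_list (m # \<mu>)). ?P (set (sigma_word 0 (m # \<mu>))) u)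
     = (\<Sum>u\<in>?W m. \<Sum>v\<in>?W (sum_list \<mu>). ?P {1..<m} u * ?P ?J v)"
    by (simp only: sum_list.Cons sum_words_append) (rule sum.cong[OF refl], rule sum.cong[OF refl], rule factor, simp)
  also have "\<dots> = block_sum \<phi> A m * (\<Prod>m\<leftarrow>\<mu>. block_sum \<phi> A m)"
    unfolding sum_product[symmetric] Cons.IH block_sum_def ..
  finally show ?case by simp
qed

text \<open>The part of \<open>block_sum \<phi> A (m + 1)\<close> that comes from words with first letter \<open>k\<close>; in terms of
  the matrix \<open>\<phi>\<close> this is a row sum of its \<open>m\<close>-th power.\<close>

definition chain_sum :: "(nat \<Rightarrow> nat \<Rightarrow> qfield) \<Rightarrow> nat set \<Rightarrow> nat \<Rightarrow> nat \<Rightarrow> qfield" where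
  "chain_sum \<phi> A k m = (\<Sum>u\<in>{u. length u = m \<and> set u \<subseteq> A}.
     \<Prod>i\<in>{1..<Suc m}. \<phi> ((k # u) ! (i - 1)) ((k # u) ! i))"

lemma sum_words_Suc:
  fixes F :: "nat list \<Rightarrow> qfield"
  assumes "finite A"
  shows "(\<Sum>u\<in>{u. length u = Suc m \<and> set u \<subseteq> A}. F u) = (\<Sum>k\<in>A. \<Sum>v\<in>{v. length v = m \<and> set v \<subseteq> A}. F (k # v))"
proof -
  have "(\<Sum>u\<in>{u. length u = Suc m \<and> set u \<subseteq> A}. F u)
     = (\<Sum>(k, v)\<in>A \<times> {v. length v = m \<and> set v \<subseteq> A}. F (k # v))"
    by (rule sum.reindex_bij_witness[where i = "\<lambda>(k, v). k # v" and j = "\<lambda>u. (hd u, tl u)"])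
      (auto simp: length_Suc_conv)
  then show ?thesis by (simp add: sum.cartesian_product)
qed

lemma block_sum_Suc: "finite A \<Longrightarrow> block_sum \<phi> A (Suc m) = (\<Sum>k\<in>A. chain_sum \<phi> A k m)"
  by (simp only: block_sum_def chain_sum_def sum_words_Suc)

lemma chain_sum_0: "chain_sum \<phi> A k 0 = 1"
proof -
  have "{u :: nat list. length u = 0 \<and> set u \<subseteq> A} = {[]}" by auto
  then show ?thesis by (simp add: chain_sum_def)
qed

lemma chain_sum_Suc:
  assumes "finite A"
  shows "chain_sum \<phi> A k (Suc m) = (\<Sum>l\<in>A. \<phi> k l * chain_sum \<phi> A l m)"
proof -
  have "(\<Prod>i\<in>{1..<Suc (Suc m)}. \<phi> ((k # l # u) ! (i - 1)) ((k # l # u) ! i))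
     = \<phi> k l * (\<Prod>i\<in>{1..<Suc m}. \<phi> ((l # u) ! (i - 1)) ((l # u) ! i))" for l u
  proof -
    have "(\<Prod>i\<in>{1..<Suc (Suc m)}. \<phi> ((k # l # u) ! (i - 1)) ((k # l # u) ! i))
       = \<phi> k l * (\<Prod>i\<in>{Suc 1..<Suc (Suc m)}. \<phi> ((k # l # u) ! (i - 1)) ((k # l # u) ! i))"
      by (subst prod.atLeast_Suc_lessThan) auto
    also have "(\<Prod>i\<in>{Suc 1..<Suc (Suc m)}. \<phi> ((k # l # u) ! (i - 1)) ((k # l # u) ! i))
       = (\<Prod>i\<in>{1..<Suc m}. \<phi> ((k # l # u) ! (Suc i - 1)) ((k # l # u) ! Suc i))"
      by (rule prod.shift_bounds_Suc_ivl)
    also have "\<dots> = (\<Prod>i\<in>{1..<Suc m}. \<phi> ((l # u) ! (i - 1)) ((l # u) ! i))"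
      by (rule prod.cong) (auto simp: nth_Cons')
    finally show ?thesis .
  qed
  then show ?thesis
    unfolding chain_sum_def sum_words_Suc[OF assms] by (simp add: sum_distrib_left)
qed

lemma block_sum_two:
  assumes "0 < m"
  shows "block_sum (stay_coeff 2) {1, 2} m = qq powi (int m - 2) * (1 + qq + of_nat m * (qq - 1))"
proof -
  let ?c = "chain_sum (stay_coeff 2) {1, 2}"
  have stay: "stay_coeff 2 1 1 = qq" "stay_coeff 2 1 2 = qq - 1" "stay_coeff 2 2 1 = 0" "stay_coeff 2 2 2 = qq"
    by (simp_all add: stay_coeff_def)
  have 2: "?c 2 k = qq ^ k" for k
    by (induction k) (simp_all add: chain_sum_0 chain_sum_Suc stay del: One_nat_def)
  have 1: "qq * ?c 1 k = qq ^ k * (qq + of_nat k * (qq - 1))" for k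
  proof (induction k)
    case (Suc k)
    have "?c 1 (Suc k) = qq * ?c 1 k + (qq - 1) * qq ^ k"
      by (simp add: chain_sum_Suc stay 2 del: One_nat_def)
    then have "qq * ?c 1 (Suc k) = qq * (qq * ?c 1 k) + qq * ((qq - 1) * qq ^ k)"
      by (simp add: distrib_left)
    then show ?case unfolding Suc by (simp add: algebra_simps)
  qed (simp add: chain_sum_0)
  obtain k where m: "m = Suc k" using assms gr0_implies_Suc by blast
  have "qq * block_sum (stay_coeff 2) {1, 2} m = qq * ?c 1 k + qq * ?c 2 k"
    by (simp add: m block_sum_Suc distrib_left)
  also have "\<dots> = qq ^ k * (1 + qq + of_nat m * (qq - 1))"
    unfolding 1 2 by (simp add: m algebra_simps)
  also have "qq ^ k = qq * qq powi (int m - 2)"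
    by (simp add: m power_int_diff power2_eq_square field_simps)
  finally show ?thesis by (simp add: mult.assoc)
qed

lemma block_sum_super:
  assumes "0 < m"
  shows "block_sum (stay_coeff 1) {1, 2} m = 2 * (-1) ^ (m - 1) * qint (- qq) m"
proof -
  let ?c = "chain_sum (stay_coeff 1) {1, 2}"
  have stay: "stay_coeff 1 1 1 = qq" "stay_coeff 1 1 2 = qq - 1" "stay_coeff 1 2 1 = 0" "stay_coeff 1 2 2 = -1"
    by (simp_all add: stay_coeff_def)
  have 2: "?c 2 k = (-1) ^ k" for k
    by (induction k) (simp_all add: chain_sum_0 chain_sum_Suc stay del: One_nat_def)
  have qint: "qint (- qq) (Suc k) = 1 - qq * qint (- qq) k" for k
    unfolding qint_def by (subst sum.lessThan_Suc_shift) (simp add: sum_distrib_left sum_negf)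
  have 1: "?c 1 k = (-1) ^ k * (2 * qint (- qq) (Suc k) - 1)" for k
  proof (induction k)
    case 0 then show ?case by (simp add: chain_sum_0 qint_def)
  next
    case (Suc k)
    have "?c 1 (Suc k) = qq * ?c 1 k + (qq - 1) * (-1) ^ k"
      by (simp add: chain_sum_Suc stay 2 del: One_nat_def)
    then show ?case unfolding Suc qint[of "Suc k"] by (simp add: algebra_simps)
  qed
  obtain k where m: "m = Suc k" using assms gr0_implies_Suc by blast
  have "block_sum (stay_coeff 1) {1, 2} m = ?c 1 k + ?c 2 k"
    by (simp add: m block_sum_Suc)
  then show ?thesis unfolding 1 2 by (simp add: m algebra_simps)
qed

lemma sign_perm_char_sigma:
  assumes "sum_list \<mu> = n"
  shows "sign_perm_char a b n (hecke_T n (sigma \<mu>)) = (\<Prod>m\<leftarrow>\<mu>. block_sum (stay_coeff a) {1..a + b} m)"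
proof -
  have w0: "distinct (sigma_word 0 \<mu>)" "set (sigma_word 0 \<mu>) \<subseteq> {1..<n}"
    using sigma_word_props[where b = 0 and \<mu> = \<mu>] assms by simp_all
  have sigma: "sigma \<mu> = perm_of_word (sigma_word 0 \<mu>)"
    by (simp add: sigma_def perm_of_sigma_word)
  show ?thesis
    using sign_perm_char_distinct[OF reduced_expr_of_distinct(1)[OF w0] reduced_expr_of_distinct(2)[OF w0], of a b]
      sum_words_blocks[where \<mu> = \<mu> and A = "{1..a + b}" and \<phi> = "stay_coeff a"]
    by (simp add: sigma assms)
qed

lemma sign_perm_char_1_1:
  assumes "\<mu> \<in> partitions_of n" 
  shows "sign_perm_char 1 1 n (hecke_T n (sigma \<mu>))
     = 2 ^ length \<mu> * (-1) ^ (n - length \<mu>) * (\<Prod>m\<leftarrow>\<mu>. qint (- qq) m)"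
proof -
  have pos: "\<forall>m\<in>set \<mu>. 0 < m" and sum: "sum_list \<mu> = n" using assms by (auto simp: partitions_of_def)
  have "(\<Prod>m\<leftarrow>\<mu>. block_sum (stay_coeff 1) {1, 2} m)
      = 2 ^ length \<mu> * (-1) ^ (sum_list \<mu> - length \<mu>) * (\<Prod>m\<leftarrow>\<mu>. qint (- qq) m)"
    using pos
  proof (induction \<mu>)
    case (Cons m \<mu>)
    have "length \<mu> \<le> sum_list \<mu>" using Cons.prems by (induction \<mu>) auto
    then have "m + sum_list \<mu> - Suc (length \<mu>) = (m - 1) + (sum_list \<mu> - length \<mu>)"
      using Cons.prems by auto
    then have pow: "(-1 :: qfield) ^ (m + sum_list \<mu> - Suc (length \<mu>)) = (-1) ^ (m - 1) * (-1) ^ (sum_list \<mu> - length \<mu>)"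
      by (simp only: power_add)
    then show ?case using Cons by (simp add: block_sum_super pow del: One_nat_def)
  qed simp
  moreover have "{1..1 + 1} = {1, 2 :: nat}" by auto
  ultimately show ?thesis using sign_perm_char_sigma[OF sum, of 1 1] sum by (simp only:)
qed

lemma sign_perm_char_2_0:
  assumes "\<mu> \<in> partitions_of n" 
  shows "sign_perm_char 2 0 n (hecke_T n (sigma \<mu>))
     = qq powi (int n - 2 * int (length \<mu>)) * (\<Prod>m\<leftarrow>\<mu>. 1 + qq + of_nat m * (qq - 1))"
proof -
  have pos: "\<forall>m\<in>set \<mu>. 0 < m" and sum: "sum_list \<mu> = n" using assms by (auto simp: partitions_of_def)
  have "(\<Prod>m\<leftarrow>\<mu>. block_sum (stay_coeff 2) {1, 2} m)
      = qq powi (int (sum_list \<mu>) - 2 * int (length \<mu>)) * (\<Prod>m\<leftarrow>\<mu>. 1 + qq + of_nat m * (qq - 1))"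
    using pos
  proof (induction \<mu>)
    case (Cons m \<mu>)
    have "int (m + sum_list \<mu>) - 2 * int (Suc (length \<mu>))
      = (int m - 2) + (int (sum_list \<mu>) - 2 * int (length \<mu>))" by simp
    then show ?case using Cons by (simp add: block_sum_two power_int_add del: of_nat_add of_nat_Suc One_nat_def)
  qed simp
  moreover have "{1..2 + 0} = {1, 2 :: nat}" by auto
  ultimately show ?thesis using sign_perm_char_sigma[OF sum, of 2 0] sum by (simp only:)
qed

section \<open>Sums of irreducible characters\<close>

lemma hook_partition:
  assumes "i < n" shows "hook n i \<in> partitions_of n"
  using assms by (auto simp: hook_def partitions_of_def sorted_wrt_append sum_list_replicate)
    (induction i, auto)

text \<open>The specialisation \<open>s = a = -1\<close> vanishes on the Schur functions of all shapes but the hooks,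
  where its value is \<open>2 (-1)\<^sup>n\<close>.\<close>

lemma sum_hook_characters:
  assumes n: "1 \<le> n" and \<mu>: "\<mu> \<in> partitions_of n" and \<chi>: "hecke_labeling n \<chi>"
  shows "2 * (\<Sum>i=0..n-1. \<chi> (hook n i) (hecke_T n (sigma \<mu>)))
     = 2 ^ length \<mu> * (-1) ^ (n - length \<mu>) * (\<Prod>m\<leftarrow>\<mu>. qint (- qq) m)"
proof -
  define c where "c \<nu> = \<chi> \<nu> (hecke_T n (sigma \<mu>))" for \<nu>
  have pos: "\<forall>m\<in>set \<mu>. 0 < m" and sum: "sum_list \<mu> = n" using \<mu> by (auto simp: partitions_of_def)
  have frob: "q_tilde \<mu> = (\<Sum>\<nu>\<in>partitions_of n. mconst (c \<nu>) * schur \<nu>)"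
    using \<chi> \<mu> by (simp add: hecke_labeling_def c_def)
  have hook_value: "schur_poly (-1) \<nu> (-1) = (if \<nu> \<in> hook n ` {0..n-1} then 2 * (-1) ^ n else 0)"
    if \<nu>: "\<nu> \<in> partitions_of n" for \<nu>
  proof -
    obtain k \<kappa> where k: "\<nu> = k # \<kappa>" using \<nu> n by (cases \<nu>) (auto simp: partitions_of_def)
    have p: "sorted_wrt (\<ge>) \<nu>" "0 < k" "\<forall>p\<in>set \<kappa>. 0 < p" "k + sum_list \<kappa> = n"
      using \<nu> by (auto simp: k partitions_of_def)
    have val: "schur_poly (-1) \<nu> (-1) = (-1) ^ k * 2 * (\<Prod>p\<leftarrow>\<kappa>. (-1) ^ p * of_bool (p \<le> 1))"
      unfolding schur_poly_super[OF p(1)] using p(2) by (simp add: k row_product_def)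
    show ?thesis
    proof (cases "\<forall>p\<in>set \<kappa>. p = 1")
      case True
      define l where "l = length \<kappa>"
      have \<kappa>: "\<kappa> = replicate l 1" unfolding l_def using True by (metis replicate_eqI)
      have "sum_list \<kappa> = l" by (simp add: \<kappa> sum_list_replicate)
      then have h: "k + l = n" using p(4) by simp
      then have "l \<in> {0..n-1}" "\<nu> = hook n l" using p(2) by (auto simp: hook_def k \<kappa>)
      then have "\<nu> \<in> hook n ` {0..n-1}" by blast
      moreover have "(\<Prod>p\<leftarrow>\<kappa>. (-1) ^ p * of_bool (p \<le> 1)) = (-1 :: qfield) ^ l"
        by (simp add: \<kappa> map_replicate)
      moreover have "(-1 :: qfield) ^ n = (-1) ^ k * (-1) ^ l" using h by (metis power_add)
      ultimately show ?thesis unfolding val by simp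
    next
      case False
      then have "\<nu> \<notin> hook n ` {0..n-1}" by (auto simp: k hook_def)
      moreover obtain p0 where p0: "p0 \<in> set \<kappa>" "p0 \<noteq> 1" using False by blast
      then have "1 < p0" using p(3) by (metis less_one linorder_neqE_nat less_irrefl)
      then have "0 = (-1 :: qfield) ^ p0 * of_bool (p0 \<le> 1)" by simp
      then have "(0 :: qfield) \<in> set (map (\<lambda>p. (-1) ^ p * of_bool (p \<le> 1)) \<kappa>)"
        unfolding set_map by (rule image_eqI[OF _ p0(1)])
      then have "(\<Prod>p\<leftarrow>\<kappa>. (-1) ^ p * of_bool (p \<le> 1)) = (0 :: qfield)"
        by (simp only: prod_list_zero_iff)
      ultimately show ?thesis unfolding val by simp
    qed
  qed
  have inj: "inj_on (hook n) {0..n-1}"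
    by (rule inj_onI) (auto simp: hook_def dest: arg_cong[of _ _ length])
  have sub: "hook n ` {0..n-1} \<subseteq> partitions_of n" using hook_partition n by auto
  have "q_tilde_value (-1) (-1) \<mu> = (\<Sum>\<nu>\<in>partitions_of n. if \<nu> \<in> hook n ` {0..n-1} then c \<nu> * (2 * (-1) ^ n) else 0)"
    unfolding frobenius_specialised[OF \<mu> frob] using hook_value by (intro sum.cong) auto
  also have "\<dots> = (\<Sum>\<nu>\<in>hook n ` {0..n-1}. c \<nu> * (2 * (-1) ^ n))"
    by (simp only: sum.inter_restrict[OF finite_partitions_of, symmetric] Int_absorb1[OF sub])
  also have "\<dots> = (-1) ^ n * (2 * (\<Sum>i=0..n-1. c (hook n i)))"
    unfolding sum.reindex[OF inj] by (simp add: sum_distrib_left ac_simps)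
  finally have "(-1) ^ n * (2 * (\<Sum>i=0..n-1. c (hook n i))) = (-2) ^ length \<mu> * (\<Prod>m\<leftarrow>\<mu>. qint (- qq) m)"
    unfolding q_tilde_value_super[OF pos] ..
  then have twice: "(-1) ^ n * ((-1) ^ n * (2 * (\<Sum>i=0..n-1. c (hook n i))))
      = (-1) ^ n * ((-2) ^ length \<mu> * (\<Prod>m\<leftarrow>\<mu>. qint (- qq) m))" by (rule arg_cong)
  have cancel: "(-1) ^ n * ((-1) ^ n * x) = x" for x :: qfield
    by (simp add: mult.assoc[symmetric] power_mult_distrib[symmetric])
  have sign: "(-1) ^ n * (-2) ^ length \<mu> = (2 ^ length \<mu> * (-1) ^ (n - length \<mu>) :: qfield)"
  proof -
    have "length \<mu> \<le> sum_list \<mu>" using pos by (induction \<mu>) auto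
    then have one: "(-1) ^ n = ((-1) ^ (n - length \<mu>) * (-1) ^ length \<mu> :: qfield)"
      using sum by (simp flip: power_add)
    have two: "(-1) ^ length \<mu> * (-2) ^ length \<mu> = (2 ^ length \<mu> :: qfield)"
      by (simp flip: power_mult_distrib)
    show ?thesis by (simp only: one two[symmetric] ac_simps)
  qed
  have "2 * (\<Sum>i=0..n-1. c (hook n i)) = (-1) ^ n * ((-2) ^ length \<mu> * (\<Prod>m\<leftarrow>\<mu>. qint (- qq) m))"
    using twice unfolding cancel .
  also have "\<dots> = 2 ^ length \<mu> * (-1) ^ (n - length \<mu>) * (\<Prod>m\<leftarrow>\<mu>. qint (- qq) m)"
    by (simp only: mult.assoc[symmetric] sign)
  finally show ?thesis unfolding c_def .
qed

text \<open>The specialisation \<open>s = a = 1\<close> puts two variables equal to \<open>1\<close>, so that it counts semistandard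
  tableaux with two different entries.\<close>

lemma sum_two_row_characters:
  assumes n: "1 \<le> n" and \<mu>: "\<mu> \<in> partitions_of n" and \<chi>: "hecke_labeling n \<chi>"
  shows "(\<Sum>i=0..n div 2. of_nat (n - 2 * i + 1) * \<chi> (two_row n i) (hecke_T n (sigma \<mu>)))
     = qq powi (int n - 2 * int (length \<mu>)) * (\<Prod>m\<leftarrow>\<mu>. 1 + qq + of_nat m * (qq - 1))"
proof -
  define c where "c \<nu> = \<chi> \<nu> (hecke_T n (sigma \<mu>))" for \<nu>
  have pos: "\<forall>m\<in>set \<mu>. 0 < m" and sum: "sum_list \<mu> = n" using \<mu> by (auto simp: partitions_of_def)
  have frob: "q_tilde \<mu> = (\<Sum>\<nu>\<in>partitions_of n. mconst (c \<nu>) * schur \<nu>)"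
    using \<chi> \<mu> by (simp add: hecke_labeling_def c_def)
  have two_row: "two_row n i = (if i = 0 then [n] else [n - i, i])" if "i \<in> {0..n div 2}" for i
    using that n by (auto simp: two_row_def)
  have sub: "two_row n ` {0..n div 2} \<subseteq> partitions_of n"
    using n by (auto simp: two_row partitions_of_def)
  have inj: "inj_on (two_row n) {0..n div 2}"
    by (rule inj_onI) (auto simp: two_row split: if_splits)
  have on: "schur_poly 1 (two_row n i) 1 = of_nat (n - 2 * i + 1)" if i: "i \<in> {0..n div 2}" for i
  proof -
    have "two_row n i \<in> partitions_of n" using sub i by blast
    then have "sorted_wrt (\<ge>) (two_row n i)" by (simp add: partitions_of_def)
    moreover have "n - i - i = n - 2 * i" by simp
    ultimately show ?thesis
      using schur_poly_two[of n "[]"] schur_poly_two[of "n - i" "[i]"] two_row[OF i] by (cases "i = 0") simp_all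
  qed
  have off: "schur_poly 1 \<nu> 1 = 0" if \<nu>: "\<nu> \<in> partitions_of n - two_row n ` {0..n div 2}" for \<nu>
  proof -
    have s: "sorted_wrt (\<ge>) \<nu>" and p: "\<forall>p\<in>set \<nu>. 0 < p" and size: "sum_list \<nu> = n"
      using \<nu> by (auto simp: partitions_of_def)
    obtain k \<kappa> where k: "\<nu> = k # \<kappa>" using size n by (cases \<nu>) auto
    have "\<kappa> \<noteq> []"
    proof
      assume "\<kappa> = []"
      then have "\<nu> = two_row n 0" using size k by (simp add: two_row)
      then show False using \<nu> by auto
    qed
    then obtain l \<kappa>' where l: "\<kappa> = l # \<kappa>'" by (cases \<kappa>) auto
    have "\<kappa>' \<noteq> []"
    proof
      assume "\<kappa>' = []"
      then have "l \<in> {0..n div 2}" "\<nu> = two_row n l" using s p size by (auto simp: k l two_row)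
      then show False using \<nu> by auto
    qed
    then have "\<not> (\<forall>p\<in>set \<kappa>'. p = 0)" using p by (cases \<kappa>') (auto simp: k l)
    then show ?thesis using schur_poly_two[of k \<kappa>] s by (simp add: k l)
  qed
  have "q_tilde_value 1 1 \<mu> = (\<Sum>\<nu>\<in>partitions_of n. c \<nu> * schur_poly 1 \<nu> 1)"
    by (rule frobenius_specialised[OF \<mu> frob])
  also have "\<dots> = (\<Sum>\<nu>\<in>two_row n ` {0..n div 2}. c \<nu> * schur_poly 1 \<nu> 1)"
    by (rule sum.mono_neutral_right[OF finite_partitions_of sub]) (simp add: off)
  also have "\<dots> = (\<Sum>i=0..n div 2. of_nat (n - 2 * i + 1) * c (two_row n i))"
    unfolding sum.reindex[OF inj] by (rule sum.cong) (simp_all add: on del: of_nat_add)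
  finally show ?thesis unfolding q_tilde_value_two[OF pos] by (simp add: sum c_def del: of_nat_add)
qed

theorem theorem3p1:
  fixes n :: nat and \<mu> :: "nat list"
    and \<chi> :: "nat list \<Rightarrow> free_elt set \<Rightarrow> qfield"
  assumes "1 \<le> n"
    and "\<mu> \<in> partitions_of n"
    and "hecke_labeling n \<chi>"
  shows "sign_perm_char 1 1 n (hecke_T n (sigma \<mu>))
           = 2 * (\<Sum>i=0..n-1. \<chi> (hook n i) (hecke_T n (sigma \<mu>)))
       \<and> (\<Sum>i=0..n-1. \<chi> (hook n i) (hecke_T n (sigma \<mu>)))
           = (-1) ^ (n - length \<mu>) * 2 ^ (length \<mu> - 1) * (\<Prod>m\<leftarrow>\<mu>. qint (- qq) m)
       \<and> sign_perm_char 2 0 n (hecke_T n (sigma \<mu>))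
           = (\<Sum>i=0..n div 2. of_nat (n - 2 * i + 1) * \<chi> (two_row n i) (hecke_T n (sigma \<mu>)))
       \<and> (\<Sum>i=0..n div 2. of_nat (n - 2 * i + 1) * \<chi> (two_row n i) (hecke_T n (sigma \<mu>)))
           = qq powi (int n - 2 * int (length \<mu>))
             * (\<Prod>m\<leftarrow>\<mu>. 1 + qq + of_nat m * (qq - 1))"
proof -
  have "length \<mu> = Suc (length \<mu> - 1)" using assms(1,2) by (cases \<mu>) (auto simp: partitions_of_def)
  then have pow: "(2 :: qfield) ^ length \<mu> = 2 * 2 ^ (length \<mu> - 1)" by (metis power_Suc)
  then have "2 * (\<Sum>i=0..n-1. \<chi> (hook n i) (hecke_T n (sigma \<mu>)))
      = 2 * ((-1) ^ (n - length \<mu>) * 2 ^ (length \<mu> - 1) * (\<Prod>m\<leftarrow>\<mu>. qint (- qq) m))"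
    using sum_hook_characters[OF assms] by (simp only: pow ac_simps)
  then have "(\<Sum>i=0..n-1. \<chi> (hook n i) (hecke_T n (sigma \<mu>)))
      = (-1) ^ (n - length \<mu>) * 2 ^ (length \<mu> - 1) * (\<Prod>m\<leftarrow>\<mu>. qint (- qq) m)"
    by simp
  then show ?thesis
    using sign_perm_char_1_1[OF assms(2)] sum_hook_characters[OF assms]
      sign_perm_char_2_0[OF assms(2)] sum_two_row_characters[OF assms]
    by (intro conjI) (simp_all only:)
qed

end
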